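(* Let $G$ be a Tychonoff topological group of weight ${\mathfrak c}$. Then there is a Parovičenko space $X$ such that $G_{(\delta)}$ is topologically isomorphic to a subgroup (with the subspace topology) of $\mathcal{H}(X)$.
   Context: All topological spaces (including those underlying topological groups) are assumed to be Tychonoff; in particular compact spaces are Hausdorff. ${\mathfrak c}=2^{\aleph_0}$. The weight of a space is the least cardinality of a base. A space is zero-dimensional if it has a base of clopen sets. An $F$-space is a space in which cozero-subsets are $C^*$-embedded (for normal spaces: disjoint open $F_\sigma$-subsets have disjoint closures). A Parovičenko space is a compact, zero-dimensional $F$-space of weight ${\mathfrak c}$ in which each nonempty $G_\delta$-subset has infinite interior. For a topological group $G$, its $G_\delta$-modification $G_{(\delta)}$ is the group $G$ with the topology having the $G_\delta$-subsets of $G$ as a base; it is again a topological group. For a compact space $X$, $\mathcal{H}(X)$ is the group of all homeomorphisms $X\to X$ under composition, endowed with the compact-open topology, i.e. the topology with subbase all sets $[K,U]=\{f\in\mathcal{H}(X): f(K)\subseteq U\}$, $K\subseteq X$ compact, $U\subseteq X$ open; it is a topological group. A topological isomorphism is a group isomorphism that is also a homeomorphism. *)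

theory Defs
  imports "HOL-Analysis.Analysis" "HOL-Algebra.Bij"
begin

unbundle cardinal_syntax

section \<open>Topological notions\<close>

definition is_base :: "'a topology \<Rightarrow> 'a set set \<Rightarrow> bool" where
  "is_base T \<B> \<longleftrightarrow>
     (\<forall>V \<in> \<B>. openin T V) \<and>
     (\<forall>U x. openin T U \<and> x \<in> U \<longrightarrow> (\<exists>V \<in> \<B>. x \<in> V \<and> V \<subseteq> U))"

text \<open>
  Cardinals of different types cannot be quantified over uniformly, so the weight is rendered as a
  relation between a space and a cardinal \<open>r\<close>: some base has cardinality \<open>r\<close>, and
  no base has smaller cardinality.
\<close>

definition has_weight :: "'a topology \<Rightarrow> 'b rel \<Rightarrow> bool" where
  "has_weight T r \<longleftrightarrow>
     (\<exists>\<B>. is_base T \<B> \<and> |\<B>| =o r) \<and> (\<forall>\<B>. is_base T \<B> \<longrightarrow> r \<le>o |\<B>| )"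

abbreviation continuum :: "nat set rel" where
  "continuum \<equiv> |UNIV :: nat set set|"

definition Tychonoff_space :: "'a topology \<Rightarrow> bool" where
  "Tychonoff_space T \<longleftrightarrow> completely_regular_space T \<and> Hausdorff_space T"

definition zero_dimensional_space :: "'a topology \<Rightarrow> bool" where
  "zero_dimensional_space T \<longleftrightarrow> (\<exists>\<B>. is_base T \<B> \<and> (\<forall>V \<in> \<B>. closedin T V))"

definition cozero_in :: "'a topology \<Rightarrow> 'a set \<Rightarrow> bool" where
  "cozero_in T S \<longleftrightarrow>
     (\<exists>f. continuous_map T euclideanreal f \<and> S = {x \<in> topspace T. f x \<noteq> 0})"

definition C_star_embedded_in :: "'a topology \<Rightarrow> 'a set \<Rightarrow> bool" where
  "C_star_embedded_in T S \<longleftrightarrow> S \<subseteq> topspace T \<and>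
     (\<forall>f. continuous_map (subtopology T S) euclideanreal f \<and> bounded (f ` S) \<longrightarrow>
       (\<exists>g. continuous_map T euclideanreal g \<and> bounded (g ` topspace T) \<and>
            (\<forall>x \<in> S. g x = f x)))"

definition F_space :: "'a topology \<Rightarrow> bool" where
  "F_space T \<longleftrightarrow> Tychonoff_space T \<and> (\<forall>S. cozero_in T S \<longrightarrow> C_star_embedded_in T S)"

definition Parovicenko_space :: "'a topology \<Rightarrow> bool" where
  "Parovicenko_space X \<longleftrightarrow>
     compact_space X \<and> Hausdorff_space X \<and> zero_dimensional_space X \<and> F_space X \<and>
     has_weight X continuum \<and>
     (\<forall>S. gdelta_in X S \<and> S \<noteq> {} \<longrightarrow> infinite (X interior_of S))"

definition gdelta_modification :: "'a topology \<Rightarrow> 'a topology" where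
  "gdelta_modification T = topology (arbitrary union_of gdelta_in T)"

lemma openin_gdelta_modification:
  "openin (gdelta_modification T) = arbitrary union_of gdelta_in T"
proof -
  have "istopology (arbitrary union_of gdelta_in T)"
    by (rule istopology_base) (rule gdelta_in_Int)
  then show ?thesis
    unfolding gdelta_modification_def by (rule topology_inverse')
qed

lemma is_base_gdelta_modification:
  "is_base (gdelta_modification T) {S. gdelta_in T S}"
  using openin_gdelta_modification[of T]
  unfolding is_base_def openin_topology_base_unique by auto

lemma topspace_gdelta_modification: "topspace (gdelta_modification T) = topspace T"
proof
  show "topspace (gdelta_modification T) \<subseteq> topspace T"
    using is_base_gdelta_modification[of T] gdelta_in_subset[of T]
    unfolding is_base_def by (metis (no_types, lifting) mem_Collect_eq openin_topspace subset_iff)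
  show "topspace T \<subseteq> topspace (gdelta_modification T)"
    using is_base_gdelta_modification[of T] gdelta_in_topspace[of T]
    unfolding is_base_def by (auto dest: openin_subset)
qed

section \<open>Topological groups and homeomorphism groups\<close>

definition topological_group :: "('a, 'm) monoid_scheme \<Rightarrow> 'a topology \<Rightarrow> bool" where
  "topological_group G T \<longleftrightarrow>
     group G \<and> topspace T = carrier G \<and>
     continuous_map (prod_topology T T) T (\<lambda>(x, y). x \<otimes>\<^bsub>G\<^esub> y) \<and>
     continuous_map T T (\<lambda>x. inv\<^bsub>G\<^esub> x)"

text \<open>
  As in \<^const>\<open>BijGroup\<close>, a self-map of the space is represented by its unique
  extensional representative (equal to \<^const>\<open>undefined\<close> off \<^term>\<open>topspace X\<close>).
\<close>

definition homeomorphisms :: "'a topology \<Rightarrow> ('a \<Rightarrow> 'a) set" where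
  "homeomorphisms X = {f \<in> extensional (topspace X). homeomorphic_map X X f}"

definition homeo_group :: "'a topology \<Rightarrow> ('a \<Rightarrow> 'a) monoid" where
  "homeo_group X = BijGroup (topspace X) \<lparr>carrier := homeomorphisms X\<rparr>"

definition compact_open_topology :: "'a topology \<Rightarrow> ('a \<Rightarrow> 'a) topology" where
  "compact_open_topology X =
     topology_generated_by
       {{f \<in> homeomorphisms X. f ` K \<subseteq> U} | K U. compactin X K \<and> openin X U}"

lemma topspace_compact_open_topology: "topspace (compact_open_topology X) = homeomorphisms X"
proof -
  have "homeomorphisms X = {f \<in> homeomorphisms X. f ` {} \<subseteq> topspace X}" by simp
  then have "homeomorphisms X \<in>
      {{f \<in> homeomorphisms X. f ` K \<subseteq> U} | K U. compactin X K \<and> openin X U}"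
    using compactin_empty openin_topspace by blast
  then show ?thesis
    unfolding compact_open_topology_def topology_generated_by_topspace by blast
qed

lemma subgroup_homeomorphisms: "subgroup (homeomorphisms X) (BijGroup (topspace X))"
proof -
  let ?S = "topspace X"
  interpret B: group "BijGroup ?S" by (rule group_BijGroup)
  have sub: "homeomorphisms X \<subseteq> Bij ?S"
    unfolding homeomorphisms_def Bij_def bij_betw_def
    using homeomorphic_imp_injective_map homeomorphic_imp_surjective_map by blast
  show ?thesis
  proof (rule B.subgroupI)
    show "homeomorphisms X \<subseteq> carrier (BijGroup ?S)"
      using sub by (simp add: BijGroup_def)
    have "homeomorphic_map X X (\<lambda>x\<in>?S. x)"
      by (rule homeomorphic_map_eq[of X X id]) auto
    then show "homeomorphisms X \<noteq> {}"
      by (auto simp: homeomorphisms_def intro!: exI[of _ "\<lambda>x\<in>?S. x"])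
  next
    fix f assume f: "f \<in> homeomorphisms X"
    then have hf: "homeomorphic_map X X f" by (simp add: homeomorphisms_def)
    then obtain g where g: "homeomorphic_maps X X f g"
      using homeomorphic_map_maps by blast
    then have hg: "homeomorphic_map X X g"
      using homeomorphic_maps_map by blast
    have "inv_into ?S f x = g x" if "x \<in> ?S" for x
      by (metis g hf hg homeomorphic_imp_injective_map homeomorphic_imp_surjective_map
          homeomorphic_maps_map image_eqI inv_into_f_eq that)
    then have "homeomorphic_map X X (\<lambda>x\<in>?S. inv_into ?S f x)"
      by (intro homeomorphic_map_eq[OF hg]) auto
    then show "inv\<^bsub>BijGroup ?S\<^esub> f \<in> homeomorphisms X"
      using f sub by (auto simp: inv_BijGroup homeomorphisms_def)
  next
    fix f g assume fg: "f \<in> homeomorphisms X" "g \<in> homeomorphisms X"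
    then have "homeomorphic_map X X (f \<circ> g)"
      by (auto simp: homeomorphisms_def intro: homeomorphic_map_compose)
    then have "homeomorphic_map X X (compose ?S f g)"
      by (rule homeomorphic_map_eq) (simp add: compose_def)
    then show "f \<otimes>\<^bsub>BijGroup ?S\<^esub> g \<in> homeomorphisms X"
      using fg sub by (auto simp: BijGroup_def homeomorphisms_def)
  qed
qed

lemma group_homeo_group: "group (homeo_group X)"
  unfolding homeo_group_def
  using group.subgroup_imp_group[OF group_BijGroup subgroup_homeomorphisms] .

definition topological_isomorphism ::
    "('a, 'm) monoid_scheme \<Rightarrow> 'a topology \<Rightarrow> ('b, 'n) monoid_scheme \<Rightarrow> 'b topology
      \<Rightarrow> ('a \<Rightarrow> 'b) \<Rightarrow> bool" where
  "topological_isomorphism G S H T \<phi> \<longleftrightarrow> \<phi> \<in> iso G H \<and> homeomorphic_map S T \<phi>"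

end

theory Submission
  imports Defs
begin

text \<open>
  Every G-delta neighbourhood of the identity contains a subgroup that is an intersection of
  countably many basic open sets. There are at most continuum many cosets of such subgroups;
  let \<open>A\<close> be the algebra of sets determined by finitely many of them. Left translation acts on
  \<open>A\<close>, the stabilizer of each member is a G-delta neighbourhood of the identity, and the stabilizers
  of the subgroups themselves are arbitrarily small. The reduced power of \<open>A\<close>, sequences in \<open>A\<close> modulo
  finite support, is atomless, separates countable orthogonal families and has positive lower bounds
  of decreasing positive sequences, so its Stone space is Parovicenko. The coordinatewise action
  still has G-delta stabilizers, because these are closed under countable intersections, and the
  constant sequences keep them arbitrarily small. Since clopen sets generate the compact-open
  topology of a compact zero-dimensional space, the induced map into the homeomorphism
  group is an embedding of the G-delta modification.
\<close>

section \<open>Stone spaces of quotients of coded set algebras\<close>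

text \<open>A group of weight continuum can have more than continuum many elements: a product of
  continuum many two-element groups is an example. So cosets cannot be counted through
  representatives; each must be recovered from countably many basic open sets. The algebra
  determined by the cosets may have atoms, and nothing in its construction provides countable
  interpolation. Sequences modulo finite support gain these properties by diagonal arguments that
  work for any algebra, without the continuum hypothesis. The passage costs no size, because a
  sequence of subsets of the naturals is again coded by one subset of the naturals.\<close>

text \<open>
  The points of the Stone space of \<open>M / I\<close> are the ultrafilters of \<open>M\<close> that avoid \<open>I\<close>. Such an
  ultrafilter is represented by its preimage under the surjection \<open>dec\<close>, so that the type of points
  depends only on the type of codes.
\<close>

locale stone_algebra = algebra \<Omega> M for \<Omega> :: "'b set" and M +
  fixes I :: "'b set set" and dec :: "'i \<Rightarrow> 'b set"
  assumes range_dec: "range dec = M"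
    and ideal_sub: "I \<subseteq> M"
    and ideal_empty: "{} \<in> I"
    and ideal_Un: "\<lbrakk>a \<in> I; b \<in> I\<rbrakk> \<Longrightarrow> a \<union> b \<in> I"
    and ideal_down: "\<lbrakk>a \<in> I; b \<in> M; b \<subseteq> a\<rbrakk> \<Longrightarrow> b \<in> I"
begin

definition ult :: "'b set set \<Rightarrow> bool" where
  "ult u \<longleftrightarrow> u \<subseteq> M \<and> u \<inter> I = {} \<and> (\<forall>a\<in>u. \<forall>b\<in>u. a \<inter> b \<in> u) \<and> (\<forall>a\<in>M. a \<in> u \<or> \<Omega> - a \<in> u)"

lemma ult_Diff_iff:
  assumes "ult u" "a \<in> M" shows "\<Omega> - a \<in> u \<longleftrightarrow> a \<notin> u"
proof -
  have "a \<inter> (\<Omega> - a) = {}" by auto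
  then show ?thesis using assms ideal_empty unfolding ult_def by (metis disjoint_iff)
qed

text \<open>Upward closure, even modulo \<open>I\<close>, follows from the clauses of
  \<open>ult\<close>: otherwise \<open>\<Omega> - b\<close> belongs to \<open>u\<close>, and its
  meet with \<open>a\<close> is the ideal element \<open>a - b\<close>.\<close>

lemma ult_mono:
  assumes "ult u" "a \<in> u" "b \<in> M" "a - b \<in> I" shows "b \<in> u"
proof (rule ccontr)
  assume "b \<notin> u"
  then have "\<Omega> - b \<in> u" using assms by (auto simp: ult_def)
  then have "a \<inter> (\<Omega> - b) \<in> u" using assms by (auto simp: ult_def)
  moreover have "a \<inter> (\<Omega> - b) = a - b"
    using assms sets_into_space[of a] by (auto simp: ult_def)
  ultimately show False using assms by (auto simp: ult_def)
qed

lemma ult_Int_iff: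
  assumes "ult u" "a \<in> M" "b \<in> M" shows "a \<inter> b \<in> u \<longleftrightarrow> a \<in> u \<and> b \<in> u"
proof
  have "a \<inter> b - a = {}" "a \<inter> b - b = {}" by auto
  then show "a \<inter> b \<in> u \<Longrightarrow> a \<in> u \<and> b \<in> u"
    using ult_mono[OF assms(1)] assms ideal_empty by metis
qed (use assms in \<open>auto simp: ult_def\<close>)

text \<open>Zorn's lemma for the families above \<open>F\<close> whose finite meets avoid
  \<open>I\<close>. If a maximal family contained neither \<open>a\<close> nor its complement, a
  finite meet would be null on each side, and together these would give a null finite meet. The
  factor \<open>\<Omega>\<close> is there for \<open>D = {}\<close>, where \<open>\<Inter>D\<close>
  is the universe.\<close>

lemma ult_extend:
  assumes F: "F \<subseteq> M" and fip: "\<And>D. finite D \<Longrightarrow> D \<subseteq> F \<Longrightarrow> \<Omega> \<inter> \<Inter>D \<notin> I"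
  obtains u where "ult u" "F \<subseteq> u"
proof -
  define P where "P = {E. F \<subseteq> E \<and> E \<subseteq> M \<and> (\<forall>D. finite D \<longrightarrow> D \<subseteq> E \<longrightarrow> \<Omega> \<inter> \<Inter>D \<notin> I)}"
  have "\<exists>u\<in>P. \<forall>E\<in>P. u \<subseteq> E \<longrightarrow> E = u"
  proof (rule subset_Zorn_nonempty)
    show "P \<noteq> {}" using assms by (auto simp: P_def)
  next
    fix C assume C: "C \<noteq> {}" "subset.chain P C"
    then have CP: "C \<subseteq> P" by (auto simp: subset_chain_def)
    have "\<Omega> \<inter> \<Inter>D \<notin> I" if D: "finite D" "D \<subseteq> \<Union>C" for D
    proof -
      obtain B where "B \<in> C" "D \<subseteq> B" using finite_subset_Union_chain[OF D C] .
      then show ?thesis using CP D by (auto simp: P_def)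
    qed
    then show "\<Union>C \<in> P" using CP C(1) unfolding P_def by blast
  qed
  then obtain u where u: "u \<in> P" and max: "\<And>E. E \<in> P \<Longrightarrow> u \<subseteq> E \<Longrightarrow> E = u" by metis
  have uM: "u \<subseteq> M" and Fu: "F \<subseteq> u" using u by (auto simp: P_def)
  have ufip: "\<Omega> \<inter> \<Inter>D \<notin> I" if "finite D" "D \<subseteq> u" for D using u that by (auto simp: P_def)
  have mem: "\<Omega> \<inter> \<Inter>D \<in> M" if "finite D" "D \<subseteq> M" for D
    using that by (induction D) (auto simp: Int_left_commute)
  \<comment> \<open>Maximality in usable form: whatever is compatible with all finite meets of
    \<open>u\<close> already lies in \<open>u\<close>.\<close>
  have new: "a \<in> u" if a: "a \<in> M" and *: "\<And>D. finite D \<Longrightarrow> D \<subseteq> u \<Longrightarrow> \<Omega> \<inter> \<Inter>D \<inter> a \<notin> I" for a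
  proof -
    have "\<Omega> \<inter> \<Inter>D \<notin> I" if D: "finite D" "D \<subseteq> insert a u" for D
    proof
      assume "\<Omega> \<inter> \<Inter>D \<in> I"
      moreover have "\<Omega> \<inter> \<Inter>(D - {a}) \<inter> a \<in> M"
        using D uM a by (intro Int[OF mem]) auto
      moreover have "\<Omega> \<inter> \<Inter>(D - {a}) \<inter> a \<subseteq> \<Omega> \<inter> \<Inter>D" by auto
      ultimately have "\<Omega> \<inter> \<Inter>(D - {a}) \<inter> a \<in> I" by (rule ideal_down)
      then show False using *[of "D - {a}"] D by auto
    qed
    then have "insert a u \<in> P" using a uM Fu by (auto simp: P_def)
    then show ?thesis using max by blast
  qed
  have "ult u"
    unfolding ult_def
  proof (intro conjI ballI)
    show "u \<subseteq> M" by fact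
    show "u \<inter> I = {}"
    proof -
      have "a \<notin> I" if "a \<in> u" for a
        using ufip[of "{a}"] that uM sets_into_space[of a] by (auto simp: Int_absorb1)
      then show ?thesis by auto
    qed
  next
    fix a b assume ab: "a \<in> u" "b \<in> u"
    show "a \<inter> b \<in> u"
    proof (rule new)
      show "a \<inter> b \<in> M" using ab uM by auto
      fix D assume "finite D" "D \<subseteq> u"
      then show "\<Omega> \<inter> \<Inter>D \<inter> (a \<inter> b) \<notin> I"
        using ufip[of "insert a (insert b D)"] ab by (simp add: Int_ac)
    qed
  next
    fix a assume a: "a \<in> M"
    show "a \<in> u \<or> \<Omega> - a \<in> u"
    proof (rule ccontr)
      assume "\<not> ?thesis"
      then obtain D D' where D: "finite D" "D \<subseteq> u" "\<Omega> \<inter> \<Inter>D \<inter> a \<in> I"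
        and D': "finite D'" "D' \<subseteq> u" "\<Omega> \<inter> \<Inter>D' \<inter> (\<Omega> - a) \<in> I"
        using new a by (metis compl_sets)
      have "\<Omega> \<inter> \<Inter>(D \<union> D') \<in> I"
      proof (rule ideal_down)
        show "(\<Omega> \<inter> \<Inter>D \<inter> a) \<union> (\<Omega> \<inter> \<Inter>D' \<inter> (\<Omega> - a)) \<in> I" using D D' ideal_Un by blast
        show "\<Omega> \<inter> \<Inter>(D \<union> D') \<in> M" using D D' uM by (intro mem) auto
      qed auto
      then show False using ufip[of "D \<union> D'"] D D' by auto
    qed
  qed
  then show ?thesis using Fu that by blast
qed

section \<open>Points, clopen base and topology of the Stone space\<close>

definition st :: "'b set set \<Rightarrow> 'i set" where "st u = dec -` u"

definition points :: "'i set set" where "points = st ` Collect ult"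

definition hat :: "'b set \<Rightarrow> 'i set set" where "hat a = st ` {u. ult u \<and> a \<in> u}"

definition stone_space :: "'i set topology" where
  "stone_space = topology (arbitrary union_of (\<lambda>S. S \<in> hat ` M))"

lemma dec_st: "ult u \<Longrightarrow> dec ` st u = u"
  using range_dec unfolding st_def ult_def by (metis image_vimage_eq inf.absorb_iff1 inf_commute)

lemma st_eq_iff: "ult u \<Longrightarrow> ult v \<Longrightarrow> st u = st v \<longleftrightarrow> u = v"
  using dec_st by metis

lemma st_in_hat [simp]: "ult u \<Longrightarrow> st u \<in> hat a \<longleftrightarrow> a \<in> u"
  by (auto simp: hat_def st_eq_iff)

lemma st_in_points [simp]: "ult u \<Longrightarrow> st u \<in> points"
  by (auto simp: points_def)

lemma points_cases:
  assumes "p \<in> points" obtains u where "ult u" "p = st u"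
  using assms by (auto simp: points_def)

lemma hat_sub: "hat a \<subseteq> points"
  by (auto simp: hat_def points_def)

lemma hat_eqI: "(\<And>u. ult u \<Longrightarrow> st u \<in> S \<longleftrightarrow> a \<in> u) \<Longrightarrow> S \<subseteq> points \<Longrightarrow> hat a = S"
  by (auto simp: hat_def points_def)

lemma hat_Int: "a \<in> M \<Longrightarrow> b \<in> M \<Longrightarrow> hat (a \<inter> b) = hat a \<inter> hat b"
  using hat_sub by (intro hat_eqI) (auto simp: ult_Int_iff)

lemma hat_Diff: "a \<in> M \<Longrightarrow> hat (\<Omega> - a) = points - hat a"
  by (intro hat_eqI) (auto simp: ult_Diff_iff)

lemma hat_ideal: "a \<in> I \<Longrightarrow> hat a = {}"
  by (rule hat_eqI) (auto simp: ult_def)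

lemma hat_space: "hat \<Omega> = points"
  using hat_Diff[of "{}"] hat_ideal[OF ideal_empty] by auto

lemma hat_Un: 
  assumes "a \<in> M" "b \<in> M" shows "hat (a \<union> b) = hat a \<union> hat b"
proof -
  have *: "a \<union> b = \<Omega> - ((\<Omega> - a) \<inter> (\<Omega> - b))" using assms sets_into_space by blast
  have "hat (a \<union> b) = points - ((points - hat a) \<inter> (points - hat b))"
    by (subst *) (simp add: assms hat_Diff hat_Int Int compl_sets)
  then show ?thesis using hat_sub[of a] hat_sub[of b] by blast
qed

text \<open>If \<open>a - b\<close> is not null, an ultrafilter through it is a point of
  \<open>hat a\<close> outside \<open>hat b\<close>. This is the dictionary between clopen sets and
  the quotient algebra.\<close>

lemma hat_subset_iff:
  assumes "a \<in> M" "b \<in> M" shows "hat a \<subseteq> hat b \<longleftrightarrow> a - b \<in> I"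
proof
  assume sub: "hat a \<subseteq> hat b"
  show "a - b \<in> I"
  proof (rule ccontr)
    assume "a - b \<notin> I"
    have "\<exists>u. ult u \<and> {a - b} \<subseteq> u"
    proof (rule ult_extend)
      show "{a - b} \<subseteq> M" using assms by auto
      fix D assume "finite D" "D \<subseteq> {a - b}"
      then have "D = {} \<or> D = {a - b}" by auto
      moreover have "\<Omega> \<notin> I" using \<open>a - b \<notin> I\<close> ideal_down[of \<Omega> "a - b"] assms sets_into_space[of "a - b"] by blast
      moreover have "\<Omega> \<inter> (a - b) = a - b" using assms sets_into_space[of a] by auto
      ultimately show "\<Omega> \<inter> \<Inter>D \<notin> I" using \<open>a - b \<notin> I\<close> by auto
    qed auto
    then obtain u where u: "ult u" "a - b \<in> u" by auto
    have "a - b = a \<inter> (\<Omega> - b)" using assms sets_into_space[of a] by auto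
    then have "a \<in> u" "b \<notin> u" using u assms ult_Int_iff[of u a "\<Omega> - b"] ult_Diff_iff by auto
    then show False using sub u(1) st_in_hat by blast
  qed
next
  assume "a - b \<in> I"
  then show "hat a \<subseteq> hat b" using ult_mono assms unfolding hat_def by blast
qed

lemma hat_empty_iff: "a \<in> M \<Longrightarrow> hat a = {} \<longleftrightarrow> a \<in> I"
  using hat_subset_iff[of a "{}"] hat_ideal[OF ideal_empty] by auto

lemma openin_stone_space: "openin stone_space = arbitrary union_of (\<lambda>S. S \<in> hat ` M)"
proof -
  have "istopology (arbitrary union_of (\<lambda>S. S \<in> hat ` M))"
  proof (rule istopology_base)
    fix S T assume "S \<in> hat ` M" "T \<in> hat ` M"
    then obtain a b where "a \<in> M" "b \<in> M" "S = hat a" "T = hat b" by auto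
    then have "S \<inter> T = hat (a \<inter> b)" "a \<inter> b \<in> M" by (simp_all add: hat_Int Int)
    then show "S \<inter> T \<in> hat ` M" by auto
  qed
  then show ?thesis unfolding stone_space_def by (rule topology_inverse')
qed

lemma base_hat: "is_base stone_space (hat ` M)"
  using openin_stone_space unfolding is_base_def openin_topology_base_unique by auto

lemma openin_hat [intro]: "a \<in> M \<Longrightarrow> openin stone_space (hat a)"
  using base_hat by (auto simp: is_base_def)

lemma topspace_stone [simp]: "topspace stone_space = points"
proof
  show "topspace stone_space \<subseteq> points"
  proof
    fix x assume "x \<in> topspace stone_space"
    then obtain a where "x \<in> hat a" using base_hat unfolding is_base_def by blast
    then show "x \<in> points" using hat_sub by blast
  qed
  show "points \<subseteq> topspace stone_space"
    using openin_subset[OF openin_hat[of \<Omega>]] hat_space by auto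
qed

lemma closedin_hat [intro]: "a \<in> M \<Longrightarrow> closedin stone_space (hat a)"
  using openin_hat[of "\<Omega> - a"] hat_Diff[of a] hat_sub unfolding closedin_def by auto

lemma openin_stone_nbhd:
  assumes "openin stone_space U" "p \<in> U"
  obtains a where "a \<in> M" "p \<in> hat a" "hat a \<subseteq> U"
proof -
  have "\<exists>V\<in>hat ` M. p \<in> V \<and> V \<subseteq> U" using base_hat assms by (simp add: is_base_def)
  then show ?thesis using that by blast
qed

lemma hat_UN:
  assumes "finite D" "D \<subseteq> M" shows "\<Union>D \<in> M \<and> hat (\<Union>D) = \<Union>(hat ` D)"
  using assms
proof (induction D)
  case empty
  then show ?case by (simp add: hat_ideal[OF ideal_empty])
next
  case (insert a D)
  then show ?case using hat_Un[of a "\<Union>D"] by auto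
qed

text \<open>If no finite part of \<open>E\<close> covers the space, the complements of its members
  have nonnull finite meets, and an ultrafilter containing all of them is a point that the cover
  misses.\<close>

lemma compact_space_stone: "compact_space stone_space"
  unfolding compact_space_alt
proof (intro allI impI, elim conjE)
  fix \<U> assume op: "\<forall>U\<in>\<U>. openin stone_space U" and cov: "topspace stone_space \<subseteq> \<Union>\<U>"
  define E where "E = {a \<in> M. \<exists>U\<in>\<U>. hat a \<subseteq> U}"
  have "\<exists>D. finite D \<and> D \<subseteq> E \<and> hat (\<Union>D) = points"
  proof (rule ccontr)
    assume no: "\<not> ?thesis"
    have "\<exists>u. ult u \<and> (\<lambda>a. \<Omega> - a) ` E \<subseteq> u"
    proof (rule ult_extend)
      show "(\<lambda>a. \<Omega> - a) ` E \<subseteq> M" by (auto simp: E_def)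
      fix D assume "finite D" "D \<subseteq> (\<lambda>a. \<Omega> - a) ` E"
      then obtain D' where D': "finite D'" "D' \<subseteq> E" "D = (\<lambda>a. \<Omega> - a) ` D'"
        using finite_subset_image by metis
      have M: "\<Union>D' \<in> M" using D' hat_UN by (auto simp: E_def)
      have "\<Omega> \<inter> \<Inter>D = \<Omega> - \<Union>D'" unfolding D'(3) by blast
      moreover have "\<Omega> - \<Union>D' \<notin> I"
      proof
        assume "\<Omega> - \<Union>D' \<in> I"
        then have "points - hat (\<Union>D') = {}" using hat_Diff[OF M] hat_ideal by simp
        then have "hat (\<Union>D') = points" using hat_sub[of "\<Union>D'"] by blast
        then show False using no D' by blast
      qed
      ultimately show "\<Omega> \<inter> \<Inter>D \<notin> I" by simp
    qed auto
    then obtain u where u: "ult u" "\<And>a. a \<in> E \<Longrightarrow> \<Omega> - a \<in> u" by auto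
    then obtain U where "U \<in> \<U>" "st u \<in> U" using cov by (metis UnionE st_in_points subsetD topspace_stone)
    then obtain a where a: "a \<in> M" "st u \<in> hat a" "hat a \<subseteq> U" using op openin_stone_nbhd by metis
    then have "a \<in> E" using \<open>U \<in> \<U>\<close> by (auto simp: E_def)
    then show False using a u ult_Diff_iff by auto
  qed
  then obtain D where D: "finite D" "D \<subseteq> E" "hat (\<Union>D) = points" by blast
  then have "\<forall>a\<in>D. \<exists>U\<in>\<U>. hat a \<subseteq> U" by (auto simp: E_def)
  then obtain f where f: "\<And>a. a \<in> D \<Longrightarrow> f a \<in> \<U> \<and> hat a \<subseteq> f a" by metis
  have "hat (\<Union>D) = \<Union>(hat ` D)" using D hat_UN[of D] by (auto simp: E_def)
  then have "topspace stone_space \<subseteq> \<Union>(f ` D)" using D f by (auto; blast)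
  then show "\<exists>F. finite F \<and> F \<subseteq> \<U> \<and> topspace stone_space \<subseteq> \<Union>F"
    using D f by (intro exI[of _ "f ` D"]) auto
qed

lemma Hausdorff_stone: "Hausdorff_space stone_space"
  unfolding Hausdorff_space_def
proof (intro allI impI, elim conjE)
  fix p q assume pq: "p \<in> topspace stone_space" "q \<in> topspace stone_space" "p \<noteq> q"
  then obtain u v where uv: "ult u" "ult v" "p = st u" "q = st v" "u \<noteq> v"
    using points_cases by (metis topspace_stone)
  \<comment> \<open>Inclusion between ultrafilters is equality, because complements reverse it; so
    some \<open>a\<close> separates the two points.\<close>
  have "\<not> u \<subseteq> v"
  proof
    assume "u \<subseteq> v"
    have "a \<in> u" if "a \<in> v" for a
    proof -
      have "a \<in> M" using uv that by (auto simp: ult_def)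
      then show ?thesis using ult_Diff_iff[OF uv(1)] ult_Diff_iff[OF uv(2)] that \<open>u \<subseteq> v\<close> by blast
    qed
    then show False using uv \<open>u \<subseteq> v\<close> by auto
  qed
  then obtain a where a: "a \<in> u" "a \<notin> v" by auto
  then have M: "a \<in> M" using uv by (auto simp: ult_def)
  show "\<exists>U V. openin stone_space U \<and> openin stone_space V \<and> p \<in> U \<and> q \<in> V \<and> disjnt U V"
    using M uv a hat_Diff[OF M] openin_hat[of "\<Omega> - a"]
    by (intro exI[of _ "hat a"] exI[of _ "hat (\<Omega> - a)"]) (auto simp: disjnt_def)
qed

lemma zero_dimensional_stone: "zero_dimensional_space stone_space"
  unfolding zero_dimensional_space_def using base_hat by (intro exI[of _ "hat ` M"]) auto

lemma compact_hat: "a \<in> M \<Longrightarrow> compactin stone_space (hat a)"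
  using closedin_compact_space[OF compact_space_stone closedin_hat] .

text \<open>Finitely many of the clopen sets inside \<open>U\<close> cover \<open>K\<close>, and
  their union is again some \<open>hat a\<close>. This lets a member of the algebra stand in for a
  compact set.\<close>

lemma hat_between:
  assumes K: "compactin stone_space K" and U: "openin stone_space U" and "K \<subseteq> U"
  obtains a where "a \<in> M" "K \<subseteq> hat a" "hat a \<subseteq> U"
proof -
  define E where "E = {a \<in> M. hat a \<subseteq> U}"
  have "K \<subseteq> \<Union>(hat ` E)"
  proof
    fix p assume "p \<in> K"
    then have "p \<in> U" using assms(3) by auto
    then obtain a where "a \<in> M" "p \<in> hat a" "hat a \<subseteq> U" using openin_stone_nbhd[OF U] by metis
    then show "p \<in> \<Union>(hat ` E)" by (auto simp: E_def)
  qed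
  moreover have "\<forall>V\<in>hat ` E. openin stone_space V" by (auto simp: E_def)
  ultimately obtain F where F: "finite F" "F \<subseteq> hat ` E" "K \<subseteq> \<Union>F"
    using K unfolding compactin_def by meson
  then obtain D where D: "finite D" "D \<subseteq> E" "F = hat ` D" using finite_subset_image by metis
  then have "\<Union>D \<in> M" "hat (\<Union>D) = \<Union>F" using hat_UN[of D] by (auto simp: E_def)
  moreover have "\<Union>F \<subseteq> U" using D by (auto simp: E_def)
  ultimately show ?thesis using that F by metis
qed

end

section \<open>A criterion for Parovicenko spaces\<close>

context stone_algebra
begin

lemma positive_set_hat_union:
  assumes S: "cozero_in stone_space S"
    and h: "continuous_map (subtopology stone_space S) euclideanreal h"
  obtains a :: "nat \<Rightarrow> 'b set" where "range a \<subseteq> M" "{x \<in> S. h x > 0} = (\<Union>n. hat (a n))"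
proof -
  obtain \<phi> where \<phi>: "continuous_map stone_space euclideanreal \<phi>" "S = {x \<in> topspace stone_space. \<phi> x \<noteq> 0}"
    using S by (auto simp: cozero_in_def)
  have Sop: "openin stone_space S"
    using openin_continuous_map_preimage[OF \<phi>(1), of "- {0}"] unfolding \<phi>(2) by auto
  define V where "V = {x \<in> S. h x > 0}"
  \<comment> \<open>\<open>h\<close> is continuous only on \<open>S\<close>, so its level sets need
    not be closed in the whole space. Cutting with a level set of \<open>\<bar>\<phi>\<bar>\<close>,
    which stays away from the complement of \<open>S\<close>, makes them closed and hence
    compact.\<close>
  define C where "C n = {x \<in> points. \<bar>\<phi> x\<bar> \<ge> 1 / Suc n} \<inter> {x \<in> S. h x \<ge> 1 / Suc n}" for n
  have SP: "S \<subseteq> points" using \<phi>(2) by auto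
  have "openin (subtopology stone_space S) {x \<in> topspace (subtopology stone_space S). h x \<in> {0<..}}"
    by (rule openin_continuous_map_preimage[OF h]) auto
  then have V: "openin stone_space V"
    using Sop SP by (simp add: V_def openin_open_subtopology inf.absorb2)
  have C: "closedin stone_space (C n)" for n
  proof -
    have cont: "continuous_map stone_space euclideanreal (\<lambda>x. \<bar>\<phi> x\<bar>)"
      by (intro continuous_intros \<phi>(1))
    have 1: "closedin stone_space {x \<in> topspace stone_space. \<bar>\<phi> x\<bar> \<in> {1 / Suc n..}}"
      by (rule closedin_continuous_map_preimage[OF cont]) auto
    have "closedin (subtopology stone_space S) {x \<in> topspace (subtopology stone_space S). h x \<in> {1 / Suc n..}}"
      by (rule closedin_continuous_map_preimage[OF h]) auto
    then obtain D where D: "closedin stone_space D" "{x \<in> S. h x \<ge> 1 / Suc n} = D \<inter> S"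
      using SP by (auto simp: closedin_subtopology inf.absorb2)
    have "C n = {x \<in> topspace stone_space. \<bar>\<phi> x\<bar> \<in> {1 / Suc n..}} \<inter> D"
    proof -
      have "x \<in> S" if "x \<in> points" "\<bar>\<phi> x\<bar> \<ge> 1 / Suc n" for x
      proof -
        have "(0::real) < 1 / Suc n" by simp
        then show ?thesis using that unfolding \<phi>(2) by auto
      qed
      then show ?thesis unfolding C_def D(2) by auto
    qed
    then show ?thesis using 1 D(1) by auto
  qed
  have CV: "C n \<subseteq> V" for n
  proof
    fix x assume "x \<in> C n"
    then have x: "x \<in> S" "1 / Suc n \<le> h x" by (auto simp: C_def)
    have "(0::real) < 1 / Suc n" by simp
    then show "x \<in> V" using x less_le_trans unfolding V_def by blast
  qed
  have "\<exists>a. a \<in> M \<and> C n \<subseteq> hat a \<and> hat a \<subseteq> V" for n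
    by (rule hat_between[OF closedin_compact_space[OF compact_space_stone C] V CV]) blast
  then obtain a where a: "\<And>n. a n \<in> M \<and> C n \<subseteq> hat (a n) \<and> hat (a n) \<subseteq> V" by metis
  have "x \<in> (\<Union>n. hat (a n))" if "x \<in> V" for x
  proof -
    have "0 < min \<bar>\<phi> x\<bar> (h x)" using that unfolding V_def \<phi>(2) by auto
    then obtain n where "inverse (Suc n) < min \<bar>\<phi> x\<bar> (h x)" using reals_Archimedean by blast
    then have "x \<in> C n" using that SP by (auto simp: C_def V_def inverse_eq_divide)
    then show ?thesis using a by blast
  qed
  then have "V = (\<Union>n. hat (a n))" using a by blast
  then show ?thesis using that[of a] a by (auto simp: V_def)
qed

lemma normal_space_stone: "normal_space stone_space"
  by (simp add: compact_Hausdorff_or_regular_imp_normal_space compact_space_stone Hausdorff_stone)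

end

text \<open>Each condition serves one clause: \<open>separation\<close> gives the F-space property,
  \<open>lower_bound\<close> nonempty interiors of nonempty G-delta sets, \<open>splitting\<close>
  makes these interiors infinite, and \<open>almost_disjoint\<close> bounds the weight from below.
  The upper bound is hidden in the type of \<open>dec\<close>, whose codes are sets of
  naturals.\<close>

locale parovicenko_algebra = stone_algebra \<Omega> M I dec
  for \<Omega> :: "'b set" and M I and dec :: "nat set \<Rightarrow> 'b set" +
  assumes separation: "\<lbrakk>range a \<subseteq> M; range c \<subseteq> M; \<And>n m :: nat. a n \<inter> c m \<in> I\<rbrakk>
      \<Longrightarrow> \<exists>d\<in>M. (\<forall>n. a n - d \<in> I) \<and> (\<forall>m. d \<inter> c m \<in> I)"
    and lower_bound: "\<lbrakk>range a \<subseteq> M; \<And>n :: nat. (\<Inter>i\<le>n. a i) \<notin> I\<rbrakk>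
      \<Longrightarrow> \<exists>b\<in>M. b \<notin> I \<and> (\<forall>n. b - a n \<in> I)"
    and splitting: "\<lbrakk>e \<in> M; e \<notin> I\<rbrakk> \<Longrightarrow> \<exists>b\<in>M. b \<subseteq> e \<and> b \<notin> I \<and> e - b \<notin> I"
    and almost_disjoint: "\<exists>D :: nat set \<Rightarrow> 'b set. range D \<subseteq> M - I \<and> (\<forall>x y. x \<noteq> y \<longrightarrow> D x \<inter> D y \<in> I)"
begin

text \<open>The positive and the negative set of \<open>h\<close> are countable unions of clopen
  sets; these form two orthogonal countable families, which \<open>separation\<close> splits by a
  single element.\<close>

lemma separating_hat:
  assumes S: "cozero_in stone_space S"
    and h: "continuous_map (subtopology stone_space S) euclideanreal h"
  obtains d where "d \<in> M" "{x \<in> S. h x > 0} \<subseteq> hat d" "{x \<in> S. h x < 0} \<inter> hat d = {}"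
proof -
  obtain a where a: "range a \<subseteq> M" "{x \<in> S. h x > 0} = (\<Union>n::nat. hat (a n))"
    using positive_set_hat_union[OF S h] .
  have "continuous_map (subtopology stone_space S) euclideanreal (\<lambda>x. - h x)"
    by (intro continuous_intros h)
  from positive_set_hat_union[OF S this]
  obtain c where c: "range c \<subseteq> M" "{x \<in> S. h x < 0} = (\<Union>n::nat. hat (c n))"
    by auto
  have "a n \<inter> c m \<in> I" for n m
  proof -
    have M: "a n \<in> M" "c m \<in> M" using a c by auto
    have "hat (a n) \<inter> hat (c m) \<subseteq> {x \<in> S. h x > 0} \<inter> {x \<in> S. h x < 0}"
      unfolding a(2) c(2) by blast
    also have "\<dots> = {}" by auto
    finally have "hat (a n) \<inter> hat (c m) = {}" by simp
    then show ?thesis using M hat_empty_iff[of "a n \<inter> c m"] hat_Int by auto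
  qed
  then obtain d where d: "d \<in> M" "\<And>n. a n - d \<in> I" "\<And>m. d \<inter> c m \<in> I"
    using separation[OF a(1) c(1)] by metis
  have "hat (a n) \<subseteq> hat d" for n using hat_subset_iff[of "a n" d] a d by auto
  moreover have "hat (c m) \<inter> hat d = {}" for m
  proof -
    have "c m \<in> M" using c by auto
    then show ?thesis using hat_Int[OF d(1), of "c m"] hat_ideal[OF d(3), of m] by auto
  qed
  ultimately show ?thesis using that[OF d(1)] unfolding a(2) c(2) by blast
qed

text \<open>A Urysohn-type construction: for every real \<open>r\<close> one clopen set
  \<open>hat (d r)\<close> contains the points of \<open>S\<close> where \<open>f\<close> is below
  \<open>r\<close> and avoids those where it is above. The extension at a point of the closure is
  the infimum of the \<open>r\<close> whose set contains it.\<close>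

lemma C_star_embedded_cozero:
  assumes S: "cozero_in stone_space S"
  shows "C_star_embedded_in stone_space S"
  unfolding C_star_embedded_in_def
proof (intro conjI allI impI; (elim conjE)?)
  show SP: "S \<subseteq> topspace stone_space" using S by (auto simp: cozero_in_def)
  fix f assume f: "continuous_map (subtopology stone_space S) euclideanreal f" and bd: "bounded (f ` S)"
  obtain B where "0 < B" and B: "\<And>x. x \<in> S \<Longrightarrow> \<bar>f x\<bar> \<le> B" using bd by (auto simp: bounded_pos)
  \<comment> \<open>Levels beyond the bound \<open>B\<close> get the empty set or the whole space,
    so that also off \<open>S\<close> the infimum is over a nonempty set bounded below and lies in
    \<open>[- B, B]\<close>.\<close>
  have "\<exists>d. d \<in> M \<and> {x \<in> S. f x < r} \<subseteq> hat d \<and> {x \<in> S. f x > r} \<inter> hat d = {} \<and>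
      (r < - B \<longrightarrow> hat d = {}) \<and> (r > B \<longrightarrow> hat d = points)" for r
  proof -
    consider "r < - B" | "r > B" "\<not> r < - B" | "\<not> r < - B" "\<not> r > B" by blast
    then show ?thesis
    proof cases
      case 1
      then have "{x \<in> S. f x < r} = {}" using B by fastforce
      then show ?thesis using 1 hat_ideal[OF ideal_empty] \<open>0 < B\<close>
        by (intro exI[of _ "{}"]) auto
    next
      case 2
      then have "{x \<in> S. f x > r} = {}" using B by fastforce
      then show ?thesis using 2 SP by (intro exI[of _ \<Omega>]) (auto simp: hat_space)
    next
      case 3
      have "continuous_map (subtopology stone_space S) euclideanreal (\<lambda>x. r - f x)"
        by (intro continuous_intros f)
      from separating_hat[OF S this] obtain d where
        "d \<in> M" "{x \<in> S. r - f x > 0} \<subseteq> hat d" "{x \<in> S. r - f x < 0} \<inter> hat d = {}" .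
      with 3 show ?thesis by (intro exI[of _ d]) auto
    qed
  qed
  from choice[OF allI[OF this]] obtain d where "\<forall>r. d r \<in> M \<and> {x \<in> S. f x < r} \<subseteq> hat (d r) \<and>
      {x \<in> S. f x > r} \<inter> hat (d r) = {} \<and> (r < - B \<longrightarrow> hat (d r) = {}) \<and> (r > B \<longrightarrow> hat (d r) = points)" ..
  then have d: "d r \<in> M" "{x \<in> S. f x < r} \<subseteq> hat (d r)" "{x \<in> S. f x > r} \<inter> hat (d r) = {}"
      "r < - B \<Longrightarrow> hat (d r) = {}" "r > B \<Longrightarrow> hat (d r) = points" for r by blast+
  define Y where "Y = stone_space closure_of S"
  have SY: "S \<subseteq> Y" using SP closure_of_subset unfolding Y_def by blast
  \<comment> \<open>The difference of two clopen sets is open; if it contained a point of the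
    closure of \<open>S\<close>, it would meet \<open>S\<close>, where \<open>f\<close> would be at
    most \<open>r\<close> and at least \<open>s\<close>.\<close>
  have mono: "x \<in> hat (d s)" if rsx: "r < s" "x \<in> Y" "x \<in> hat (d r)" for r s x
  proof (rule ccontr)
    assume x: "x \<notin> hat (d s)"
    have "openin stone_space (hat (d r) - hat (d s))" using d(1) by (intro openin_diff) auto
    moreover have "x \<in> hat (d r) - hat (d s)" using x rsx by auto
    ultimately obtain y where y: "y \<in> S" "y \<in> hat (d r) - hat (d s)"
      using rsx(2) unfolding Y_def in_closure_of by blast
    then have "f y \<le> r" "s \<le> f y" using d(2)[of s] d(3)[of r] by (auto simp: not_less[symmetric])
    then show False using rsx by auto
  qed
  have YP: "Y \<subseteq> points" unfolding Y_def using closure_of_subset_topspace[of stone_space S] by auto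
  \<comment> \<open>The sets \<open>hat (d r)\<close> increase with \<open>r\<close> only on the closure of \<open>S\<close>; the extension \<open>g\<close> is built there
    and then continued to the whole space by Tietze's theorem.\<close>
  define R where "R x = {r. x \<in> hat (d r)}" for x
  define g where "g x = Inf (R x)" for x
  have RB: "- B \<le> r" if "r \<in> R x" for r x using that d(4)[of r] by (force simp: R_def)
  have BR: "r \<in> R x" if "r > B" "x \<in> Y" for r x using that d(5)[of r] YP by (auto simp: R_def)
  have R: "R x \<noteq> {}" "bdd_below (R x)" if "x \<in> Y" for x
    using BR[OF _ that, of "B + 1"] RB by (auto intro!: bdd_belowI[of _ "- B"])
  have g_lt: "g x < a \<longleftrightarrow> (\<exists>r\<in>R x. r < a)" if "x \<in> Y" for x a
    unfolding g_def by (rule cInf_less_iff[OF R[OF that]])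
  have gB: "g x \<le> B" if "x \<in> Y" for x
  proof (rule dense_ge)
    fix z assume "B < z"
    then show "g x \<le> z" using cInf_lower[OF BR[OF _ that] R(2)[OF that]] by (simp add: g_def)
  qed
  have gL: "- B \<le> g x" if "x \<in> Y" for x
    unfolding g_def by (rule cInf_greatest[OF R(1)[OF that] RB])
  \<comment> \<open>Together with \<open>g_lt\<close> this exhibits the strict sublevel and
    superlevel sets of \<open>g\<close> as traces of unions of clopen sets, which is continuity.
    Monotonicity enters only in this half.\<close>
  have gt: "a < g x \<longleftrightarrow> (\<exists>r>a. x \<notin> hat (d r))" if x: "x \<in> Y" for x a
  proof
    assume "a < g x"
    then obtain r where r: "a < r" "r < g x" using dense by blast
    then have "r \<notin> R x" using g_lt[OF x] cInf_lower[OF _ R(2)[OF x]] unfolding g_def by fastforce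
    then show "\<exists>r>a. x \<notin> hat (d r)" using r by (auto simp: R_def)
  next
    assume "\<exists>r>a. x \<notin> hat (d r)"
    then obtain r where r: "r > a" "x \<notin> hat (d r)" by auto
    then have "r \<le> s" if "s \<in> R x" for s using mono[of s r x] x that by (force simp: R_def)
    then have "r \<le> g x" unfolding g_def using cInf_greatest[OF R(1)[OF x]] by blast
    then show "a < g x" using r by simp
  qed
  have gf: "g x = f x" if x: "x \<in> S" for x
  proof (rule antisym)
    have xY: "x \<in> Y" using x SY by auto
    show "g x \<le> f x"
    proof (rule dense_ge)
      fix r assume "f x < r"
      then have "r \<in> R x" using x d(2)[of r] by (auto simp: R_def)
      then show "g x \<le> r" using cInf_lower[OF _ R(2)[OF xY]] by (simp add: g_def)
    qed
    show "f x \<le> g x"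
      unfolding g_def
    proof (rule cInf_greatest[OF R(1)[OF xY]])
      fix r assume "r \<in> R x"
      then show "f x \<le> r" using x d(3)[of r] by (force simp: R_def)
    qed
  qed
  have cont: "continuous_map (subtopology stone_space Y) euclideanreal g"
    unfolding continuous_map_upper_lower_semicontinuous_lt
  proof (intro allI conjI)
    fix a :: real
    have *: "topspace (subtopology stone_space Y) = Y" using YP by auto
    have "{x \<in> Y. g x < a} = (\<Union>r\<in>{..<a}. hat (d r)) \<inter> Y"
      by (auto simp: g_lt R_def)
    moreover have "openin stone_space (\<Union>r\<in>{..<a}. hat (d r))"
      using d(1) by auto
    ultimately show "openin (subtopology stone_space Y) {x \<in> topspace (subtopology stone_space Y). g x < a}"
      unfolding * openin_subtopology by blast
    have "{x \<in> Y. a < g x} = (\<Union>r\<in>{a<..}. points - hat (d r)) \<inter> Y"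
      using YP by (auto simp: gt)
    moreover have "openin stone_space (\<Union>r\<in>{a<..}. points - hat (d r))"
      using d(1) closedin_hat by (intro openin_Union) (auto simp: closedin_def)
    ultimately show "openin (subtopology stone_space Y) {x \<in> topspace (subtopology stone_space Y). a < g x}"
      unfolding * openin_subtopology by blast
  qed
  obtain k where k: "continuous_map stone_space euclideanreal k" "\<And>x. x \<in> Y \<Longrightarrow> k x = g x"
    "k ` topspace stone_space \<subseteq> {- B..B}"
  proof (rule Tietze_extension_closed_real_interval[OF normal_space_stone _ cont])
    show "closedin stone_space Y" by (simp add: Y_def)
    show "g ` Y \<subseteq> {- B..B}" using gB gL by (fastforce)
  qed (use that \<open>0 < B\<close> in auto)
  show "\<exists>g. continuous_map stone_space euclideanreal g \<and> bounded (g ` topspace stone_space) \<and> (\<forall>x\<in>S. g x = f x)"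
    using k gf SY bounded_subset[OF bounded_closed_interval k(3)] by (intro exI[of _ k]) auto
qed

text \<open>Descent on the cardinality: a finite nonempty clopen set would properly contain a
  nonempty clopen set.\<close>

lemma infinite_hat:
  assumes "a \<in> M" "a \<notin> I" shows "infinite (hat a)"
proof
  assume "finite (hat a)"
  then show False using assms
  proof (induction "card (hat a)" arbitrary: a rule: less_induct)
    case less
    obtain b where b: "b \<in> M" "b \<subseteq> a" "b \<notin> I" "a - b \<notin> I"
      using splitting[OF less.prems(2,3)] by blast
    then have "b - a \<in> I" using ideal_empty by (simp add: Diff_eq_empty_iff[THEN iffD2])
    then have "hat b \<subset> hat a" using hat_subset_iff b less.prems by blast
    then show ?case
      using less.hyps[of b] b less.prems by (auto intro: psubset_card_mono finite_subset)
  qed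
qed

text \<open>Around a point of the G-delta set every open factor contains some
  \<open>hat (a n)\<close>. All finite meets of the \<open>a n\<close> have this point in their
  clopen sets, hence are not null, and the clopen set of a positive lower bound lies in the
  interior.\<close>

lemma interior_gdelta_infinite:
  assumes "gdelta_in stone_space S" "S \<noteq> {}"
  shows "infinite (stone_space interior_of S)"
proof -
  obtain C where C: "\<And>n::nat. openin stone_space (C n)" "S = \<Inter>(range C)"
    using assms(1) unfolding gdelta_in_descending by blast
  obtain p where p: "p \<in> S" using assms(2) by blast
  have "\<exists>a. a \<in> M \<and> p \<in> hat a \<and> hat a \<subseteq> C n" for n
  proof -
    have "p \<in> C n" using p C(2) by auto
    then show ?thesis using openin_stone_nbhd[OF C(1)] by metis
  qed
  then obtain a where a: "\<And>n. a n \<in> M" "\<And>n. p \<in> hat (a n)" "\<And>n. hat (a n) \<subseteq> C n" by metis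
  have "(\<Inter>i\<le>n. a i) \<in> M \<and> p \<in> hat (\<Inter>i\<le>n. a i)" for n
  proof (induction n)
    case (Suc n)
    then show ?case using a[of "Suc n"] hat_Int by (simp add: atMost_Suc Int)
  qed (use a in simp)
  then have "(\<Inter>i\<le>n. a i) \<notin> I" for n using hat_ideal by blast
  then obtain b where b: "b \<in> M" "b \<notin> I" "\<And>n. b - a n \<in> I"
    using lower_bound[of a] a(1) by blast
  have "hat b \<subseteq> C n" for n
    using hat_subset_iff[OF b(1) a(1)] b(3)[of n] a(3)[of n] by blast
  then have "hat b \<subseteq> S" unfolding C(2) by blast
  then have "hat b \<subseteq> stone_space interior_of S" using b by (intro interior_of_maximal) auto
  then show ?thesis using infinite_hat b finite_subset by blast
qed

text \<open>Continuum many pairwise disjoint nonempty open sets force every base to be that large;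
  conversely, the clopen base is indexed by the codes.\<close>

lemma has_weight_stone: "has_weight stone_space continuum"
  unfolding has_weight_def
proof (intro conjI allI impI)
  obtain D :: "nat set \<Rightarrow> 'b set" where "range D \<subseteq> M - I \<and> (\<forall>x y. x \<noteq> y \<longrightarrow> D x \<inter> D y \<in> I)"
    using almost_disjoint ..
  then have D: "D x \<in> M" "D x \<notin> I" "x \<noteq> y \<Longrightarrow> D x \<inter> D y \<in> I" for x y by auto
  show lower: "continuum \<le>o |\<B>|" if \<B>: "is_base stone_space \<B>" for \<B>
  proof -
    have "\<exists>V. V \<in> \<B> \<and> V \<noteq> {} \<and> V \<subseteq> hat (D x)" for x
    proof -
      have "hat (D x) \<noteq> {}" using hat_empty_iff[OF D(1)] D(2) by simp
      then obtain p where "p \<in> hat (D x)" by blast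
      then show ?thesis using \<B> openin_hat[OF D(1)] unfolding is_base_def by blast
    qed
    then obtain V where V: "\<And>x. V x \<in> \<B>" "\<And>x. V x \<noteq> {}" "\<And>x. V x \<subseteq> hat (D x)" by metis
    have "inj V"
    proof (rule injI, rule ccontr)
      fix x y assume "V x = V y" "x \<noteq> y"
      then have "V x \<subseteq> hat (D x) \<inter> hat (D y)" using V(3) by (metis Int_greatest)
      also have "\<dots> = {}" using hat_Int[OF D(1) D(1)] hat_ideal[OF D(3)[OF \<open>x \<noteq> y\<close>]] by simp
      finally show False using V(2) by simp
    qed
    then show ?thesis using V(1) by (intro card_of_ordLeqI[of V]) auto
  qed
  have "hat ` M = (\<lambda>c. hat (dec c)) ` UNIV" using range_dec by auto
  then have "|hat ` M| \<le>o continuum" using card_of_image by metis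
  then show "\<exists>\<B>. is_base stone_space \<B> \<and> |\<B>| =o continuum"
    using lower[OF base_hat] base_hat ordIso_iff_ordLeq by blast
qed

lemma Parovicenko_stone: "Parovicenko_space stone_space"
  unfolding Parovicenko_space_def F_space_def Tychonoff_space_def
  by (simp add: compact_space_stone Hausdorff_stone zero_dimensional_stone C_star_embedded_cozero
    has_weight_stone interior_gdelta_infinite
    normal_imp_completely_regular_space[OF normal_space_stone])

end

section \<open>Sequences modulo finite support\<close>

text \<open>Through the pairing function one set of naturals codes a whole sequence of such sets;
  this is what keeps countable powers of the continuum within the continuum.\<close>

definition slice :: "nat set \<Rightarrow> nat \<Rightarrow> nat set" where
  "slice c k = {j. prod_encode (k, j) \<in> c}"

lemma slice_surj: obtains c where "slice c = s"
proof
  show "slice {prod_encode (k, j) | k j. j \<in> s k} = s"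
    by (auto simp: slice_def fun_eq_iff)
qed

lemma infinite_split:
  fixes K :: "nat set"
  assumes "infinite K"
  obtains L where "L \<subseteq> K" "infinite L" "infinite (K - L)"
proof
  let ?e = "enumerate K"
  have inj: "inj ?e" using strict_mono_enumerate[OF assms] strict_mono_imp_inj_on by blast
  show "range (\<lambda>n. ?e (2 * n)) \<subseteq> K" using enumerate_in_set[OF assms] by auto
  show "infinite (range (\<lambda>n. ?e (2 * n)))"
    by (rule range_inj_infinite) (auto intro!: injI dest: injD[OF inj])
  have "infinite (range (\<lambda>n. ?e (2 * n + 1)))"
    by (rule range_inj_infinite) (auto intro!: injI dest: injD[OF inj])
  moreover have "range (\<lambda>n. ?e (2 * n + 1)) \<subseteq> K - range (\<lambda>n. ?e (2 * n))"
  proof -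
    have "2 * n + 1 \<noteq> 2 * m" for n m :: nat by presburger
    then show ?thesis using enumerate_in_set[OF assms] by (force dest: injD[OF inj])
  qed
  ultimately show "infinite (K - range (\<lambda>n. ?e (2 * n)))" using finite_subset by blast
qed

text \<open>Branches of the binary tree: the set attached to \<open>x\<close> consists of the codes
  of its initial segments, and two branches that differ at \<open>j\<close> share no node beyond
  level \<open>j\<close>.\<close>

lemma almost_disjoint_nat_sets:
  "\<exists>B :: nat set \<Rightarrow> nat set. (\<forall>x. infinite (B x)) \<and> (\<forall>x y. x \<noteq> y \<longrightarrow> finite (B x \<inter> B y))"
proof (intro exI conjI allI impI)
  let ?B = "\<lambda>x. range (\<lambda>n. prod_encode (n, set_encode (x \<inter> {..<n})))"
  show "infinite (?B x)" for x by (rule range_inj_infinite) (auto simp: inj_def)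
  fix x y :: "nat set" assume "x \<noteq> y"
  then obtain j where j: "j \<in> x \<longleftrightarrow> j \<notin> y" by auto
  have "?B x \<inter> ?B y \<subseteq> (\<lambda>n. prod_encode (n, set_encode (x \<inter> {..<n}))) ` {..j}"
  proof
    fix k assume "k \<in> ?B x \<inter> ?B y"
    then obtain n where k: "k = prod_encode (n, set_encode (x \<inter> {..<n}))"
      and "set_encode (x \<inter> {..<n}) = set_encode (y \<inter> {..<n})" by auto
    then have "x \<inter> {..<n} = y \<inter> {..<n}"
      using inj_onD[OF inj_on_set_encode] by auto
    then have "j < n \<Longrightarrow> j \<in> x \<longleftrightarrow> j \<in> y" by blast
    then have "n \<le> j" using j by linarith
    then show "k \<in> (\<lambda>n. prod_encode (n, set_encode (x \<inter> {..<n}))) ` {..j}" using k by blast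
  qed
  then show "finite (?B x \<inter> ?B y)" using finite_subset by blast
qed

locale sequence_algebra = base: algebra \<Omega> A for \<Omega> :: "'b set" and A +
  fixes E :: "nat set \<Rightarrow> 'b set"
  assumes range_E: "range E = A" and space_nonempty: "\<Omega> \<noteq> {}"
begin

text \<open>A sequence in \<open>A\<close> is stored as one relation whose section over
  \<open>k\<close> is the \<open>k\<close>-th term. Boolean operations on sequences are then set
  operations, and \<open>Domain\<close> is the support.\<close>

definition seq_sets :: "(nat \<times> 'b) set set" where
  "seq_sets = {R. \<forall>k. R `` {k} \<in> A}"

definition fin_sets :: "(nat \<times> 'b) set set" where
  "fin_sets = {R \<in> seq_sets. finite (Domain R)}"

definition dec :: "nat set \<Rightarrow> (nat \<times> 'b) set" where
  "dec c = {(k, x). x \<in> E (slice c k)}"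

lemma seq_setsI: "(\<And>k. {x. (k, x) \<in> R} \<in> A) \<Longrightarrow> R \<in> seq_sets"
  by (simp add: seq_sets_def Image_singleton)

lemma seq_setsD: "R \<in> seq_sets \<Longrightarrow> {x. (k, x) \<in> R} \<in> A"
  by (simp add: seq_sets_def Image_singleton)

lemma range_dec_seq: "range dec = seq_sets"
proof
  show "range dec \<subseteq> seq_sets" 
  proof (intro image_subsetI seq_setsI)
    fix c k show "{x. (k, x) \<in> dec c} \<in> A" using range_E by (auto simp only: dec_def mem_Collect_eq case_prod_conv Collect_mem_eq)
  qed
  show "seq_sets \<subseteq> range dec"
  proof
    fix R assume "R \<in> seq_sets"
    then have "\<forall>k. \<exists>e. E e = {x. (k, x) \<in> R}" using range_E seq_setsD by (metis rangeE)
    then obtain s where s: "\<And>k. E (s k) = {x. (k, x) \<in> R}" by metis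
    obtain c where "slice c = s" using slice_surj .
    then have "dec c = R" using s by (auto simp: dec_def)
    then show "R \<in> range dec" by blast
  qed
qed

lemma algebra_seq_sets: "algebra (UNIV \<times> \<Omega>) seq_sets"
  unfolding algebra_iff_Un
proof (intro conjI ballI)
  show "seq_sets \<subseteq> Pow (UNIV \<times> \<Omega>)"
    using base.sets_into_space seq_setsD by fastforce
  show "{} \<in> seq_sets" by (rule seq_setsI) simp
  fix R assume R: "R \<in> seq_sets"
  show "UNIV \<times> \<Omega> - R \<in> seq_sets"
  proof (rule seq_setsI)
    fix k
    have "{x. (k, x) \<in> UNIV \<times> \<Omega> - R} = \<Omega> - {x. (k, x) \<in> R}" by auto
    then show "{x. (k, x) \<in> UNIV \<times> \<Omega> - R} \<in> A" using seq_setsD[OF R] base.compl_sets by simp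
  qed
  fix S assume S: "S \<in> seq_sets"
  show "R \<union> S \<in> seq_sets"
  proof (rule seq_setsI)
    fix k
    have "{x. (k, x) \<in> R \<union> S} = {x. (k, x) \<in> R} \<union> {x. (k, x) \<in> S}" by auto
    then show "{x. (k, x) \<in> R \<union> S} \<in> A" using base.Un[OF seq_setsD[OF R] seq_setsD[OF S]] by simp
  qed
qed

sublocale seq: algebra "UNIV \<times> \<Omega>" seq_sets by (rule algebra_seq_sets)

sublocale stone_algebra "UNIV \<times> \<Omega>" seq_sets fin_sets dec
proof unfold_locales
  show "range dec = seq_sets" by (rule range_dec_seq)
  show "fin_sets \<subseteq> seq_sets" "{} \<in> fin_sets" by (auto simp: fin_sets_def)
  show "a \<union> b \<in> fin_sets" if "a \<in> fin_sets" "b \<in> fin_sets" for a b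
    using that by (auto simp: fin_sets_def Domain_Un_eq)
  show "b \<in> fin_sets" if "a \<in> fin_sets" "b \<in> seq_sets" "b \<subseteq> a" for a b
    using that finite_subset[OF Domain_mono[OF that(3)]] by (auto simp: fin_sets_def)
qed

lemma restrict_seq_sets: "R \<in> seq_sets \<Longrightarrow> R \<inter> K \<times> UNIV \<in> seq_sets"
proof (rule seq_setsI)
  fix k assume "R \<in> seq_sets"
  then show "{x. (k, x) \<in> R \<inter> K \<times> UNIV} \<in> A" using seq_setsD by (cases "k \<in> K") auto
qed

lemma seq_separation:
  fixes a c :: "nat \<Rightarrow> (nat \<times> 'b) set"
  assumes a: "range a \<subseteq> seq_sets" and c: "range c \<subseteq> seq_sets" and ac: "\<And>n m. a n \<inter> c m \<in> fin_sets"
  shows "\<exists>d\<in>seq_sets. (\<forall>n. a n - d \<in> fin_sets) \<and> (\<forall>m. d \<inter> c m \<in> fin_sets)"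
proof -
  \<comment> \<open>Only \<open>c m\<close> with \<open>m \<le> n\<close> is removed from \<open>a n\<close>, so that \<open>a n - d\<close> stays finitely supported.\<close>
  define d where "d = {(k, x). \<exists>n\<le>k. (k, x) \<in> a n \<and> (\<forall>m\<le>n. (k, x) \<notin> c m)}"
  have fin: "finite (Domain (a n \<inter> c m))" for n m using ac by (simp add: fin_sets_def)
  have d: "d \<in> seq_sets"
  proof (rule seq_setsI)
    fix k
    \<comment> \<open>The bound \<open>n \<le> k\<close> makes every section a finite combination of
      members of \<open>A\<close>, which is all that an algebra allows.\<close>
    have "{x. (k, x) \<in> d} = (\<Union>n\<in>{..k}. {x. (k, x) \<in> a n} - (\<Union>m\<in>{..n}. {x. (k, x) \<in> c m}))"
      by (auto simp: d_def)
    moreover have "\<dots> \<in> A"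
      using a c by (intro base.finite_UN base.Diff) (auto intro!: seq_setsD)
    ultimately show "{x. (k, x) \<in> d} \<in> A" by simp
  qed
  have "Domain (a n - d) \<subseteq> {..<n} \<union> (\<Union>m\<le>n. Domain (a n \<inter> c m))" for n
    by (auto simp: d_def Domain_iff not_less)
  then have "finite (Domain (a n - d))" for n
    by (rule finite_subset) (simp add: fin)
  moreover have "Domain (d \<inter> c m) \<subseteq> (\<Union>n<m. Domain (a n \<inter> c m))" for m
    by (fastforce simp: d_def Domain_iff not_less[symmetric])
  then have "finite (Domain (d \<inter> c m))" for m
    by (rule finite_subset) (simp add: fin)
  ultimately show ?thesis using d a c
    by (intro bexI[of _ d]) (auto simp: fin_sets_def intro!: seq.Diff seq.Int)
qed

text \<open>A diagonal choice: \<open>b\<close> takes over one section of each \<open>B n\<close>,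
  at a place \<open>k n\<close> of its support. The places increase strictly, so \<open>b\<close>
  has infinite support, and it can leave \<open>a n\<close> only at the finitely many places before
  \<open>k n\<close>.\<close>

lemma seq_lower_bound:
  fixes a :: "nat \<Rightarrow> (nat \<times> 'b) set"
  assumes a: "range a \<subseteq> seq_sets" and pos: "\<And>n. (\<Inter>i\<le>n. a i) \<notin> fin_sets"
  shows "\<exists>b\<in>seq_sets. b \<notin> fin_sets \<and> (\<forall>n. b - a n \<in> fin_sets)"
proof -
  define B where "B n = (\<Inter>i\<le>n. a i)" for n
  have B: "B n \<in> seq_sets" for n
    using a unfolding B_def by (intro seq.finite_INT) auto
  then have inf: "infinite (Domain (B n))" for n using pos[of n] by (auto simp: fin_sets_def B_def)
  have "\<exists>k. \<forall>n. k n \<in> Domain (B n) \<and> k n < k (Suc n)"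
  proof (rule dependent_nat_choice)
    show "\<exists>j. j \<in> Domain (B 0)" using infinite_imp_nonempty[OF inf[of 0]] by blast
    show "\<exists>j. j \<in> Domain (B (Suc n)) \<and> i < j" for i n
      using inf[of "Suc n"] unfolding infinite_nat_iff_unbounded by blast
  qed
  then obtain k where k: "\<And>n. k n \<in> Domain (B n)" "\<And>n. k n < k (Suc n)" by blast
  then have inj: "inj k" using strict_mono_imp_inj_on[OF strict_monoI_Suc] by blast
  define b where "b = (\<Union>n. B n \<inter> {k n} \<times> UNIV)"
  have b: "b \<in> seq_sets"
  proof (rule seq_setsI)
    fix j
    show "{x. (j, x) \<in> b} \<in> A"
    proof (cases "j \<in> range k")
      case True
      then obtain n where "j = k n" by auto
      then have "{x. (j, x) \<in> b} = {x. (j, x) \<in> B n}" using inj by (auto simp: b_def inj_def)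
      then show ?thesis using seq_setsD[OF B] by simp
    next
      case False
      then have "{x. (j, x) \<in> b} = {}" by (auto simp: b_def)
      then show ?thesis by simp
    qed
  qed
  have "k n \<in> Domain b" for n
  proof -
    obtain x where "(k n, x) \<in> B n" using k(1) by blast
    then show ?thesis unfolding b_def by blast
  qed
  then have "range k \<subseteq> Domain b" by blast
  then have "infinite (Domain b)" using range_inj_infinite[OF inj] finite_subset by blast
  moreover have "finite (Domain (b - a n))" for n
  proof (rule finite_subset)
    show "Domain (b - a n) \<subseteq> k ` {..<n}"
    proof
      fix j assume "j \<in> Domain (b - a n)"
      then obtain x m where "j = k m" "(j, x) \<in> B m" "(j, x) \<notin> a n" by (auto simp: b_def)
      then show "j \<in> k ` {..<n}" by (cases "m < n") (auto simp: B_def)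
    qed
  qed simp
  ultimately show ?thesis using b a by (intro bexI[of _ b]) (auto simp: fin_sets_def intro!: seq.Diff)
qed

text \<open>Elements are split by halving their infinite supports, so atoms of \<open>A\<close> do
  no harm. Almost disjoint supports filled with all of \<open>\<Omega>\<close> give the large
  orthogonal family; nonemptiness of \<open>\<Omega>\<close> makes the supports the chosen
  ones.\<close>

sublocale parovicenko_algebra "UNIV \<times> \<Omega>" seq_sets fin_sets dec
proof unfold_locales
  fix e assume e: "e \<in> seq_sets" "e \<notin> fin_sets"
  then have "infinite (Domain e)" by (simp add: fin_sets_def)
  then obtain L where L: "L \<subseteq> Domain e" "infinite L" "infinite (Domain e - L)"
    using infinite_split by metis
  have "Domain (e \<inter> L \<times> UNIV) = L" "Domain (e - e \<inter> L \<times> UNIV) = Domain e - L" using L(1) by auto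
  then show "\<exists>b\<in>seq_sets. b \<subseteq> e \<and> b \<notin> fin_sets \<and> e - b \<notin> fin_sets"
    using L e restrict_seq_sets[OF e(1)] by (intro bexI[of _ "e \<inter> L \<times> UNIV"]) (auto simp: fin_sets_def)
next
  obtain B :: "nat set \<Rightarrow> nat set" where "(\<forall>x. infinite (B x)) \<and> (\<forall>x y. x \<noteq> y \<longrightarrow> finite (B x \<inter> B y))"
    using almost_disjoint_nat_sets ..
  then have B: "infinite (B x)" "x \<noteq> y \<Longrightarrow> finite (B x \<inter> B y)" for x y by auto
  have D: "K \<times> \<Omega> \<in> seq_sets" for K
    using restrict_seq_sets[OF seq.top, of K] by (simp add: Times_Int_Times)
  have dom: "Domain (K \<times> \<Omega>) = K" for K :: "nat set" using space_nonempty by auto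
  have "B x \<times> \<Omega> \<in> seq_sets - fin_sets" for x using B(1)[of x] D by (simp add: fin_sets_def dom)
  moreover have "(B x \<times> \<Omega>) \<inter> (B y \<times> \<Omega>) \<in> fin_sets" if "x \<noteq> y" for x y
    using B(2)[OF that] D by (simp add: fin_sets_def dom Times_Int_Times)
  ultimately have "range (\<lambda>x. B x \<times> \<Omega>) \<subseteq> seq_sets - fin_sets \<and>
      (\<forall>x y. x \<noteq> y \<longrightarrow> (B x \<times> \<Omega>) \<inter> (B y \<times> \<Omega>) \<in> fin_sets)" by blast
  then show "\<exists>D :: nat set \<Rightarrow> (nat \<times> 'b) set. range D \<subseteq> seq_sets - fin_sets \<and> (\<forall>x y. x \<noteq> y \<longrightarrow> D x \<inter> D y \<in> fin_sets)"
    by (rule exI[where x = "\<lambda>x. B x \<times> \<Omega>"])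
qed (fact seq_separation seq_lower_bound)+

end

section \<open>Automorphisms acting on the Stone space\<close>

context stone_algebra
begin

text \<open>The inverse is carried along because a bijection of \<open>\<Omega>\<close> induces an
  automorphism of the quotient only if \<open>M\<close> and \<open>I\<close> are preserved in both
  directions.\<close>

definition inverse_automorphisms :: "('b \<Rightarrow> 'b) \<Rightarrow> ('b \<Rightarrow> 'b) \<Rightarrow> bool" where
  "inverse_automorphisms f f' \<longleftrightarrow>
     (\<forall>x\<in>\<Omega>. f x \<in> \<Omega> \<and> f' x \<in> \<Omega> \<and> f' (f x) = x \<and> f (f' x) = x) \<and>
     (\<forall>a\<in>M. f ` a \<in> M \<and> f' ` a \<in> M) \<and> (\<forall>a\<in>I. f ` a \<in> I \<and> f' ` a \<in> I)"

text \<open>A point is decoded to its ultrafilter, pushed forward memberwise and coded again. Direct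
  images keep the order of composition; the restriction to \<open>points\<close> follows the
  extensional convention for homeomorphisms.\<close>

definition stone_map :: "('b \<Rightarrow> 'b) \<Rightarrow> 'i set \<Rightarrow> 'i set" where
  "stone_map f = (\<lambda>p\<in>points. {c. dec c \<in> (`) f ` dec ` p})"

lemma inverse_automorphisms_sym: "inverse_automorphisms f f' \<Longrightarrow> inverse_automorphisms f' f"
  by (auto simp: inverse_automorphisms_def)

lemma inverse_automorphisms_image:
  assumes "inverse_automorphisms f f'" "a \<subseteq> \<Omega>" shows "f' ` f ` a = a" "f ` f' ` a = a"
proof -
  have "f' (f x) = x" "f (f' x) = x" if "x \<in> a" for x
    using assms that unfolding inverse_automorphisms_def by blast+
  then show "f' ` f ` a = a" "f ` f' ` a = a" by (simp_all add: image_image)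
qed

lemma ult_image:
  assumes f: "inverse_automorphisms f f'" and u: "ult u"
  shows "ult ((`) f ` u)"
  unfolding ult_def
proof (intro conjI ballI)
  have uM: "u \<subseteq> M" using u by (simp add: ult_def)
  show "(`) f ` u \<subseteq> M" using uM f by (auto simp: inverse_automorphisms_def)
  have "f ` a \<notin> I" if "a \<in> u" for a
  proof
    assume "f ` a \<in> I"
    then have "f' ` f ` a \<in> I" using f by (simp add: inverse_automorphisms_def)
    then have "a \<in> I" using inverse_automorphisms_image[OF f] that uM sets_into_space by (metis subsetD)
    then show False using u that by (auto simp: ult_def)
  qed
  then show "(`) f ` u \<inter> I = {}" by auto
next
  fix a b assume "a \<in> (`) f ` u" "b \<in> (`) f ` u"
  then obtain a' b' where ab: "a' \<in> u" "b' \<in> u" "a = f ` a'" "b = f ` b'" by auto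
  have "a' \<subseteq> \<Omega>" "b' \<subseteq> \<Omega>" using ab u sets_into_space by (auto simp: ult_def)
  moreover have "inj_on f \<Omega>" using f unfolding inverse_automorphisms_def by (metis inj_onI)
  ultimately have "a \<inter> b = f ` (a' \<inter> b')" unfolding ab by (simp add: inj_on_image_Int)
  then show "a \<inter> b \<in> (`) f ` u" using u ab by (auto simp: ult_def)
next
  fix a assume a: "a \<in> M"
  then have a': "f' ` a \<in> M" using f by (simp add: inverse_automorphisms_def)
  have inj: "inj_on f \<Omega>" using f unfolding inverse_automorphisms_def by (metis inj_onI)
  have sp: "f ` \<Omega> = \<Omega>" using f unfolding inverse_automorphisms_def by force
  have ff': "f ` f' ` a = a" using inverse_automorphisms_image(2)[OF f sets_into_space[OF a]] .
  have "f ` (\<Omega> - f' ` a) = \<Omega> - a"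
    using inj_on_image_set_diff[OF inj, of \<Omega> "f' ` a"] sets_into_space[OF a'] sp ff' by auto
  then show "a \<in> (`) f ` u \<or> \<Omega> - a \<in> (`) f ` u"
    using u a' ff' unfolding ult_def by (metis image_eqI)
qed

lemma stone_map_st: "ult u \<Longrightarrow> stone_map f (st u) = st ((`) f ` u)"
  by (simp add: stone_map_def dec_st) (auto simp: st_def)

lemma stone_map_points: "inverse_automorphisms f f' \<Longrightarrow> p \<in> points \<Longrightarrow> stone_map f p \<in> points"
  by (auto elim!: points_cases simp: stone_map_st ult_image)

lemma stone_map_comp:
  assumes "inverse_automorphisms g g'" "p \<in> points"
  shows "stone_map f (stone_map g p) = stone_map (\<lambda>x. f (g x)) p"
  using assms by (auto elim!: points_cases simp: stone_map_st ult_image image_image)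

lemma stone_map_cong:
  assumes "\<And>x. x \<in> \<Omega> \<Longrightarrow> f x = g x" shows "stone_map f = stone_map g"
proof
  fix p
  show "stone_map f p = stone_map g p"
  proof (cases "p \<in> points")
    case True
    then obtain u where u: "ult u" "p = st u" using points_cases by metis
    have "(`) f ` u = (`) g ` u"
    proof (rule image_cong)
      fix a assume "a \<in> u"
      then show "f ` a = g ` a" using u sets_into_space assms by (intro image_cong) (auto simp: ult_def)
    qed simp
    then show ?thesis using u by (simp add: stone_map_st)
  qed (simp add: stone_map_def)
qed

lemma stone_map_id: "p \<in> points \<Longrightarrow> stone_map (\<lambda>x. x) p = p"
  by (auto elim!: points_cases simp: stone_map_st)

lemma stone_map_inverse:
  assumes "inverse_automorphisms f f'" "p \<in> points" shows "stone_map f' (stone_map f p) = p"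
proof -
  have "stone_map (\<lambda>x. f' (f x)) = stone_map (\<lambda>x. x)"
    using assms by (intro stone_map_cong) (simp add: inverse_automorphisms_def)
  then show ?thesis using stone_map_comp[OF assms] stone_map_id assms by metis
qed

text \<open>The pushed-forward ultrafilter contains \<open>a\<close> exactly when the original one
  contains the image of \<open>a\<close> under \<open>f'\<close>. So preimages of basic clopen sets
  are basic clopen, which yields continuity.\<close>

lemma stone_map_in_hat:
  assumes f: "inverse_automorphisms f f'" and p: "p \<in> points" and a: "a \<in> M"
  shows "stone_map f p \<in> hat a \<longleftrightarrow> p \<in> hat (f' ` a)"
proof -
  obtain u where u: "ult u" "p = st u" using p points_cases by metis
  have "a \<in> (`) f ` u \<longleftrightarrow> f' ` a \<in> u"
  proof
    assume "a \<in> (`) f ` u"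
    then obtain b where "b \<in> u" "a = f ` b" by blast
    then show "f' ` a \<in> u"
      using inverse_automorphisms_image(1)[OF f sets_into_space, of b] u by (auto simp: ult_def)
  next
    assume "f' ` a \<in> u"
    then show "a \<in> (`) f ` u"
      using inverse_automorphisms_image(2)[OF f sets_into_space[OF a]] by (metis image_eqI)
  qed
  then show ?thesis using u ult_image[OF f] by (simp add: stone_map_st)
qed

lemma stone_map_image_hat:
  assumes f: "inverse_automorphisms f f'" and a: "a \<in> M"
  shows "stone_map f ` hat a = hat (f ` a)"
proof -
  have fa: "f ` a \<in> M" using f a by (simp add: inverse_automorphisms_def)
  have f'fa: "f' ` f ` a = a" using inverse_automorphisms_image(1)[OF f sets_into_space[OF a]] .
  show ?thesis
  proof
    show "stone_map f ` hat a \<subseteq> hat (f ` a)"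
    proof (rule image_subsetI)
      fix p assume p: "p \<in> hat a"
      then have "p \<in> points" using hat_sub by blast
      then show "stone_map f p \<in> hat (f ` a)" using stone_map_in_hat[OF f _ fa] f'fa p by simp
    qed
    show "hat (f ` a) \<subseteq> stone_map f ` hat a"
    proof
      fix q assume q: "q \<in> hat (f ` a)"
      then have qp: "q \<in> points" using hat_sub by blast
      note f' = inverse_automorphisms_sym[OF f]
      have "stone_map f' q \<in> hat a" using stone_map_in_hat[OF f' qp a] q by simp
      moreover have "q = stone_map f (stone_map f' q)" using stone_map_inverse[OF f' qp] by simp
      ultimately show "q \<in> stone_map f ` hat a" by blast
    qed
  qed
qed

lemma continuous_stone_map:
  assumes f: "inverse_automorphisms f f'"
  shows "continuous_map stone_space stone_space (stone_map f)"
proof (rule continuous_map_into_topology_base[OF openin_stone_space])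
  show "stone_map f x \<in> topspace stone_space" if "x \<in> topspace stone_space" for x
    using stone_map_points[OF f] that by simp
  fix U assume "U \<in> hat ` M"
  then obtain a where a: "a \<in> M" "U = hat a" by blast
  have "{x \<in> topspace stone_space. stone_map f x \<in> U} = hat (f' ` a)"
    using stone_map_in_hat[OF f] a hat_sub by auto
  then show "openin stone_space {x \<in> topspace stone_space. stone_map f x \<in> U}"
    using f a by (auto simp: inverse_automorphisms_def)
qed

lemma homeomorphic_stone_map:
  assumes f: "inverse_automorphisms f f'"
  shows "stone_map f \<in> homeomorphisms stone_space"
proof -
  note f' = inverse_automorphisms_sym[OF f]
  have "homeomorphic_maps stone_space stone_space (stone_map f) (stone_map f')"
    unfolding homeomorphic_maps_def
    using continuous_stone_map f f' stone_map_inverse by simp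
  then show ?thesis
    unfolding homeomorphisms_def using homeomorphic_map_maps by (auto simp: stone_map_def)
qed

end

section \<open>Sets determined by finitely many generators\<close>

text \<open>For finite \<open>\<F>\<close> this says that \<open>a\<close> meets
  \<open>\<Omega>\<close> in a union of cells of the finite partition cut out by
  \<open>\<F>\<close>; so \<open>determined_sets\<close> is the algebra generated by the traces of
  \<open>\<C>\<close>. The form through indistinguishable points avoids induction over Boolean
  terms, both in coding and under translation.\<close>

definition determines :: "'b set \<Rightarrow> 'b set set \<Rightarrow> 'b set \<Rightarrow> bool" where
  "determines \<Omega> \<F> a \<longleftrightarrow> (\<forall>x\<in>\<Omega>. \<forall>y\<in>\<Omega>. (\<forall>C\<in>\<F>. x \<in> C \<longleftrightarrow> y \<in> C) \<longrightarrow> (x \<in> a \<longleftrightarrow> y \<in> a))"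

definition determined_sets :: "'b set \<Rightarrow> 'b set set \<Rightarrow> 'b set set" where
  "determined_sets \<Omega> \<C> = {a. a \<subseteq> \<Omega> \<and> (\<exists>\<F>\<subseteq>\<C>. finite \<F> \<and> determines \<Omega> \<F> a)}"

lemma determinesD:
  "\<lbrakk>determines \<Omega> \<F> a; x \<in> \<Omega>; y \<in> \<Omega>; \<And>C. C \<in> \<F> \<Longrightarrow> x \<in> C \<longleftrightarrow> y \<in> C\<rbrakk> \<Longrightarrow> x \<in> a \<longleftrightarrow> y \<in> a"
  unfolding determines_def by blast

lemma determined_setsE:
  assumes "a \<in> determined_sets \<Omega> \<C>"
  obtains \<F> where "a \<subseteq> \<Omega>" "\<F> \<subseteq> \<C>" "finite \<F>" "determines \<Omega> \<F> a"
  using assms by (auto simp: determined_sets_def)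

lemma determined_setsI:
  "\<lbrakk>a \<subseteq> \<Omega>; \<F> \<subseteq> \<C>; finite \<F>; determines \<Omega> \<F> a\<rbrakk> \<Longrightarrow> a \<in> determined_sets \<Omega> \<C>"
  by (auto simp: determined_sets_def)

lemma empty_determined: "{} \<in> determined_sets \<Omega> \<C>"
  by (rule determined_setsI[of _ _ "{}"]) (auto simp: determines_def)

lemma algebra_determined_sets: "algebra \<Omega> (determined_sets \<Omega> \<C>)"
  unfolding algebra_iff_Un
proof (intro conjI ballI)
  show "determined_sets \<Omega> \<C> \<subseteq> Pow \<Omega>" by (auto simp: determined_sets_def)
  show "{} \<in> determined_sets \<Omega> \<C>" by (rule empty_determined)
  fix a assume a: "a \<in> determined_sets \<Omega> \<C>"
  obtain \<F> where F: "a \<subseteq> \<Omega>" "\<F> \<subseteq> \<C>" "finite \<F>" "determines \<Omega> \<F> a"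
    using determined_setsE[OF a] .
  have "determines \<Omega> \<F> (\<Omega> - a)" using F(4) unfolding determines_def by blast
  then show "\<Omega> - a \<in> determined_sets \<Omega> \<C>"
    using F by (intro determined_setsI[of _ _ \<F>]) auto
  fix b assume b: "b \<in> determined_sets \<Omega> \<C>"
  obtain \<F>' where F': "b \<subseteq> \<Omega>" "\<F>' \<subseteq> \<C>" "finite \<F>'" "determines \<Omega> \<F>' b"
    using determined_setsE[OF b] .
  have "determines \<Omega> (\<F> \<union> \<F>') (a \<union> b)"
    unfolding determines_def
  proof (intro ballI impI)
    fix x y assume xy: "x \<in> \<Omega>" "y \<in> \<Omega>" "\<forall>C\<in>\<F> \<union> \<F>'. x \<in> C \<longleftrightarrow> y \<in> C"
    have "x \<in> a \<longleftrightarrow> y \<in> a" using xy by (intro determinesD[OF F(4)]) auto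
    moreover have "x \<in> b \<longleftrightarrow> y \<in> b" using xy by (intro determinesD[OF F'(4)]) auto
    ultimately show "x \<in> a \<union> b \<longleftrightarrow> y \<in> a \<union> b" by blast
  qed
  then show "a \<union> b \<in> determined_sets \<Omega> \<C>"
    using F F' by (intro determined_setsI[of _ _ "\<F> \<union> \<F>'"]) auto
qed

lemma determined_sets_generator: "C \<in> \<C> \<Longrightarrow> C \<subseteq> \<Omega> \<Longrightarrow> C \<in> determined_sets \<Omega> \<C>"
  by (rule determined_setsI[of _ _ "{C}"]) (auto simp: determines_def)

lemma determined_sets_coded:
  fixes F :: "nat set \<Rightarrow> 'b set"
  assumes CF: "\<C> \<subseteq> range F"
  obtains E :: "nat set \<Rightarrow> 'b set" where "range E = determined_sets \<Omega> \<C>"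
proof -
  define P :: "nat set \<Rightarrow> (nat \<Rightarrow> nat set) \<Rightarrow> 'b \<Rightarrow> nat set"
    where "P N t x = {i. i \<in> N \<and> x \<in> F (t i)}" for N t x
  define H where "H c = {x \<in> \<Omega>. set_encode (P (slice c 1) (\<lambda>i. slice c (i + 2)) x) \<in> slice c 0}" for c
  have sub: "a \<in> range H" if a: "a \<in> determined_sets \<Omega> \<C>" for a
  proof -
    obtain \<F> where F: "a \<subseteq> \<Omega>" "\<F> \<subseteq> \<C>" "finite \<F>" "determines \<Omega> \<F> a"
      using determined_setsE[OF a] .
    obtain n and C :: "nat \<Rightarrow> 'b set" where C: "\<F> = C ` {..<n}"
      using finite_imp_nat_seg_image_inj_on[OF F(3)] by (auto simp: lessThan_def)
    have "\<exists>t. i < n \<longrightarrow> F t = C i" for i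
    proof (cases "i < n")
      case True
      then have "C i \<in> range F" using F(2) CF C by blast
      then show ?thesis by auto
    qed simp
    then obtain t where t: "\<And>i. i < n \<Longrightarrow> F (t i) = C i" by metis
    have fin: "finite (P {..<n} t x)" for x by (simp add: P_def)
    define Z where "Z = (\<lambda>x. set_encode (P {..<n} t x)) ` a"
    obtain c where c: "slice c = (\<lambda>i. if i = 0 then Z else if i = 1 then {..<n} else t (i - 2))"
      using slice_surj .
    have det: "x \<in> a \<longleftrightarrow> y \<in> a" if xy: "P {..<n} t x = P {..<n} t y" "x \<in> \<Omega>" "y \<in> \<Omega>" for x y
    proof (rule determinesD[OF F(4) xy(2,3)])
      fix D assume "D \<in> \<F>"
      then obtain i where "i < n" "D = F (t i)" using C t by auto
      then show "x \<in> D \<longleftrightarrow> y \<in> D" using xy(1) by (auto simp: P_def set_eq_iff)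
    qed
    have "H c = {x \<in> \<Omega>. set_encode (P {..<n} t x) \<in> Z}"
      unfolding H_def c by simp
    also have "\<dots> = a"
    proof
      show "a \<subseteq> {x \<in> \<Omega>. set_encode (P {..<n} t x) \<in> Z}" using F(1) by (auto simp: Z_def)
      show "{x \<in> \<Omega>. set_encode (P {..<n} t x) \<in> Z} \<subseteq> a"
      proof
        fix x assume "x \<in> {x \<in> \<Omega>. set_encode (P {..<n} t x) \<in> Z}"
        then obtain y where "x \<in> \<Omega>" "y \<in> a" "set_encode (P {..<n} t x) = set_encode (P {..<n} t y)"
          by (auto simp: Z_def)
        moreover from this have "P {..<n} t x = P {..<n} t y" using set_encode_eq[OF fin fin] by simp
        ultimately show "x \<in> a" using det[of x y] F(1) by auto
      qed
    qed
    finally show ?thesis by blast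
  qed
  \<comment> \<open>Codes that decode to a set outside the family are sent to the empty set, so that
    the range is exact.\<close>
  define E where "E c = (if H c \<in> determined_sets \<Omega> \<C> then H c else {})" for c
  have "range E = determined_sets \<Omega> \<C>"
  proof
    show "range E \<subseteq> determined_sets \<Omega> \<C>" using empty_determined by (auto simp: E_def)
    show "determined_sets \<Omega> \<C> \<subseteq> range E"
    proof
      fix a assume a: "a \<in> determined_sets \<Omega> \<C>"
      then obtain c where "a = H c" using sub by blast
      then have "E c = a" using a by (simp add: E_def)
      then show "a \<in> range E" by blast
    qed
  qed
  then show ?thesis using that by blast
qed

lemma gdelta_in_continuous_preimage:
  assumes f: "continuous_map X Y f" and S: "gdelta_in Y S"
  shows "gdelta_in X {x \<in> topspace X. f x \<in> S}"
proof -
  obtain C where C: "\<And>n::nat. openin Y (C n)" "\<And>n. C (Suc n) \<subseteq> C n" "\<Inter>(range C) = S"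
    using S unfolding gdelta_in_descending by blast
  show ?thesis
    unfolding gdelta_in_descending
  proof (intro exI[of _ "\<lambda>n. {x \<in> topspace X. f x \<in> C n}"] conjI allI)
    show "openin X {x \<in> topspace X. f x \<in> C n}" for n
      using openin_continuous_map_preimage[OF f C(1)] .
  qed (use C(2,3) in auto)
qed

section \<open>Cosets of G-delta subgroups\<close>

locale topological_group_base = group G for G :: "('a, 'm) monoid_scheme" (structure) +
  fixes T :: "'a topology" and \<B> :: "'a set set"
  assumes top_group: "topological_group G T" and base: "is_base T \<B>"
begin

abbreviation left_translate :: "'a \<Rightarrow> 'a set \<Rightarrow> 'a set" (infixr \<open>\<star>\<close> 75) where
  "g \<star> a \<equiv> (\<lambda>x. g \<otimes> x) ` a"

lemma topspace_T [simp]: "topspace T = carrier G"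
  using top_group by (simp add: topological_group_def)

lemma continuous_mult:
  assumes "continuous_map X T f" "continuous_map X T g"
  shows "continuous_map X T (\<lambda>x. f x \<otimes> g x)"
proof -
  have "continuous_map (prod_topology T T) T (\<lambda>(x, y). x \<otimes> y)"
    using top_group by (simp add: topological_group_def)
  from continuous_map_compose[OF continuous_map_pairedI[OF assms] this]
  show ?thesis by (simp add: o_def)
qed

lemma continuous_inv:
  assumes "continuous_map X T f" shows "continuous_map X T (\<lambda>x. inv (f x))"
proof -
  have "continuous_map T T (\<lambda>x. inv x)"
    using top_group by (simp add: topological_group_def)
  from continuous_map_compose[OF assms this] show ?thesis by (simp add: o_def)
qed

lemma continuous_translation: "h \<in> carrier G \<Longrightarrow> continuous_map T T (\<lambda>x. h \<otimes> x)"
  by (intro continuous_mult continuous_map_id[unfolded id_def] continuous_map_const[THEN iffD2]) simp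

lemma base_nbhd:
  assumes "openin T U" "x \<in> U" obtains V where "V \<in> \<B>" "x \<in> V" "V \<subseteq> U"
proof -
  have "\<exists>V\<in>\<B>. x \<in> V \<and> V \<subseteq> U" using base assms by (simp add: is_base_def)
  then show ?thesis using that by blast
qed

text \<open>Intersections of members of the base are taken, not arbitrary G-delta subgroups: such a
  subgroup is given by a sequence of base members, hence by one code as soon as the base is
  coded.\<close>

definition basic_subgroups :: "'a set set" where
  "basic_subgroups = {N. subgroup N G \<and> (\<exists>V :: nat \<Rightarrow> 'a set. range V \<subseteq> \<B> \<and> N = (\<Inter>n. V n))}"

definition basic_cosets :: "'a set set" where
  "basic_cosets = {h \<star> N | h N. h \<in> carrier G \<and> N \<in> basic_subgroups}"

lemma difference_nbhd:
  assumes V: "openin T V" "\<one> \<in> V" and C: "openin T C" "\<one> \<in> C"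
  obtains W where "W \<in> \<B>" "\<one> \<in> W" "W \<subseteq> C" "\<And>x y. x \<in> W \<Longrightarrow> y \<in> W \<Longrightarrow> x \<otimes> inv y \<in> V"
proof -
  let ?P = "{z \<in> topspace (prod_topology T T). fst z \<otimes> inv (snd z) \<in> V}"
  have "continuous_map (prod_topology T T) T (\<lambda>z. fst z \<otimes> inv (snd z))"
    by (intro continuous_mult continuous_inv continuous_map_fst continuous_map_snd)
  then have "openin (prod_topology T T) ?P"
    using V(1) by (rule openin_continuous_map_preimage)
  moreover have "(\<one>, \<one>) \<in> ?P" using V(2) by simp
  ultimately obtain A B where AB: "openin T A" "openin T B" "\<one> \<in> A" "\<one> \<in> B" "A \<times> B \<subseteq> ?P"
    unfolding openin_prod_topology_alt by meson
  then have "openin T (A \<inter> B \<inter> C)" "\<one> \<in> A \<inter> B \<inter> C" using C by auto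
  then obtain W where W: "W \<in> \<B>" "\<one> \<in> W" "W \<subseteq> A \<inter> B \<inter> C" using base_nbhd by metis
  have "x \<otimes> inv y \<in> V" if "x \<in> W" "y \<in> W" for x y
  proof -
    have "(x, y) \<in> ?P" using that W(3) AB(5) by blast
    then show ?thesis by simp
  qed
  then show ?thesis using that W by blast
qed

text \<open>If all quotients \<open>x \<otimes> inv y\<close> from \<open>V (Suc n)\<close> lie in
  \<open>V n\<close>, the intersection of the \<open>V n\<close> is closed under such quotients and
  so is a subgroup. Choosing \<open>V n\<close> inside \<open>C n\<close> keeps it inside
  \<open>S\<close>.\<close>

lemma basic_subgroup_in_gdelta:
  assumes S: "gdelta_in T S" and one: "\<one> \<in> S"
  obtains N where "N \<in> basic_subgroups" "N \<subseteq> S"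
proof -
  obtain C where C: "\<And>n::nat. openin T (C n)" "\<Inter>(range C) = S"
    using S unfolding gdelta_in_descending by blast
  have Bopen: "openin T V" if "V \<in> \<B>" for V using base that by (simp add: is_base_def)
  have "\<exists>V. \<forall>n. (V n \<in> \<B> \<and> \<one> \<in> V n \<and> V n \<subseteq> C n) \<and> (\<forall>x\<in>V (Suc n). \<forall>y\<in>V (Suc n). x \<otimes> inv y \<in> V n)"
  proof (rule dependent_nat_choice)
    have "\<one> \<in> C 0" using one C(2) by blast
    from base_nbhd[OF C(1) this] show "\<exists>V. V \<in> \<B> \<and> \<one> \<in> V \<and> V \<subseteq> C 0" by blast
    fix V n assume "V \<in> \<B> \<and> \<one> \<in> V \<and> V \<subseteq> C n"
    then have V: "openin T V" "\<one> \<in> V" using Bopen by auto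
    have "\<one> \<in> C (Suc n)" using one C(2) by blast
    from difference_nbhd[OF V C(1) this]
    show "\<exists>W. (W \<in> \<B> \<and> \<one> \<in> W \<and> W \<subseteq> C (Suc n)) \<and> (\<forall>x\<in>W. \<forall>y\<in>W. x \<otimes> inv y \<in> V)" by metis
  qed
  then obtain V where V: "\<And>n::nat. V n \<in> \<B>" "\<And>n. \<one> \<in> V n" "\<And>n. V n \<subseteq> C n"
    "\<And>n x y. x \<in> V (Suc n) \<Longrightarrow> y \<in> V (Suc n) \<Longrightarrow> x \<otimes> inv y \<in> V n" by blast
  define N where "N = (\<Inter>n. V n)"
  have sub: "N \<subseteq> carrier G"
    using openin_subset[OF Bopen[OF V(1)[of 0]]] by (auto simp: N_def)
  have diff: "x \<otimes> inv y \<in> N" if "x \<in> N" "y \<in> N" for x y using that V(4) by (auto simp: N_def)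
  have one_N: "\<one> \<in> N" using V(2) by (simp add: N_def)
  have inv_N: "inv y \<in> N" if "y \<in> N" for y
  proof -
    have "y \<in> carrier G" using that sub by auto
    then show ?thesis using diff[OF one_N that] by simp
  qed
  have "subgroup N G"
  proof (rule subgroupI)
    show "x \<otimes> y \<in> N" if "x \<in> N" "y \<in> N" for x y
    proof -
      have "y \<in> carrier G" using that sub by auto
      then show ?thesis using diff[OF that(1) inv_N[OF that(2)]] by simp
    qed
  qed (use sub one_N inv_N in auto)
  moreover have "range V \<subseteq> \<B>" using V(1) by blast
  ultimately have "N \<in> basic_subgroups" unfolding basic_subgroups_def N_def by blast
  moreover have "N \<subseteq> S" using V(3) C(2) by (auto simp: N_def)
  ultimately show ?thesis using that by blast
qed

lemma basic_subgroupD: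
  assumes "N \<in> basic_subgroups" shows "subgroup N G" "gdelta_in T N"
proof -
  show "subgroup N G" using assms by (simp add: basic_subgroups_def)
  obtain V :: "nat \<Rightarrow> 'a set" where V: "range V \<subseteq> \<B>" "N = \<Inter>(range V)"
    using assms by (auto simp: basic_subgroups_def)
  show "gdelta_in T N"
    unfolding V(2) using V(1) base
    by (intro gdelta_in_Inter) (auto simp: is_base_def intro!: open_imp_gdelta_in)
qed

lemma mem_translate_iff:
  assumes "h \<in> carrier G" "K \<subseteq> carrier G" "x \<in> carrier G"
  shows "x \<in> h \<star> K \<longleftrightarrow> inv h \<otimes> x \<in> K"
proof
  assume "x \<in> h \<star> K"
  then obtain k where "k \<in> K" "x = h \<otimes> k" by auto
  moreover from this have "k \<in> carrier G" using assms by auto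
  ultimately show "inv h \<otimes> x \<in> K" using assms by (simp add: m_assoc[symmetric])
next
  assume "inv h \<otimes> x \<in> K"
  moreover have "x = h \<otimes> (inv h \<otimes> x)" using assms by (simp add: m_assoc[symmetric])
  ultimately show "x \<in> h \<star> K" by blast
qed

lemma translate_carrier: "h \<in> carrier G \<Longrightarrow> K \<subseteq> carrier G \<Longrightarrow> h \<star> K \<subseteq> carrier G"
  by auto

lemma openin_translate:
  assumes "h \<in> carrier G" "openin T V" shows "openin T (h \<star> V)"
proof -
  have V: "V \<subseteq> carrier G" using openin_subset[OF assms(2)] by simp
  have "h \<star> V = {x \<in> topspace T. inv h \<otimes> x \<in> V}"
    using mem_translate_iff[OF assms(1) V] translate_carrier[OF assms(1) V] by auto
  then show ?thesis
    using openin_continuous_map_preimage[OF continuous_translation[of "inv h"] assms(2)] assms(1) by simp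
qed

text \<open>A coset \<open>h \<star> N\<close> is recovered from basic neighbourhoods \<open>U n\<close> of \<open>h\<close> inside \<open>h \<star> V n\<close>,
  as the product of \<open>\<Inter>n. U n\<close> and \<open>N = (\<Inter>n. V n)\<close>.\<close>

lemma basic_cosets_coded:
  fixes b :: "nat set \<Rightarrow> 'a set"
  assumes b: "\<B> \<subseteq> range b"
  obtains F :: "nat set \<Rightarrow> 'a set" where "basic_cosets \<subseteq> range F"
proof -
  \<comment> \<open>Even slices code the neighbourhoods of \<open>h\<close>, odd slices those sets
    whose intersection is the subgroup. The representative \<open>h\<close> itself is never coded,
    as the group may be too large for that.\<close>
  define F where "F c = {u \<otimes> k | u k. u \<in> (\<Inter>n. b (slice c (2 * n))) \<and> k \<in> (\<Inter>n. b (slice c (2 * n + 1)))}" for c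
  have "D \<in> range F" if "D \<in> basic_cosets" for D
  proof -
    obtain h N where D: "D = h \<star> N" "h \<in> carrier G" "N \<in> basic_subgroups"
      using \<open>D \<in> basic_cosets\<close> by (auto simp: basic_cosets_def)
    have N: "subgroup N G" using D(3) by (simp add: basic_subgroups_def)
    interpret N: subgroup N G by (rule N)
    obtain V :: "nat \<Rightarrow> 'a set" where V: "range V \<subseteq> \<B>" "N = (\<Inter>n. V n)"
      using D(3) by (auto simp: basic_subgroups_def)
    have Vop: "openin T (V n)" for n using V(1) base by (auto simp: is_base_def)
    have "h \<in> h \<star> V n" for n
      using mem_translate_iff[OF D(2) _ D(2)] openin_subset[OF Vop] V(2) N.one_closed D(2) by auto
    then have "\<exists>W. W \<in> \<B> \<and> h \<in> W \<and> W \<subseteq> h \<star> V n" for n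
      using base_nbhd[OF openin_translate[OF D(2) Vop]] by metis
    then obtain W where W: "\<And>n. W n \<in> \<B>" "\<And>n. h \<in> W n" "\<And>n. W n \<subseteq> h \<star> V n" by metis
    obtain v w where vw: "\<And>n. b (v n) = V n" "\<And>n. b (w n) = W n"
    proof -
      have "\<exists>v. b v = V n" "\<exists>w. b w = W n" for n using b V(1) W(1) by (metis rangeE rangeI subsetD)+
      then show ?thesis using that by metis
    qed
    obtain c where "slice c = (\<lambda>n. if even n then w (n div 2) else v (n div 2))"
      using slice_surj .
    then have Fc: "F c = {u \<otimes> k | u k. u \<in> (\<Inter>n. W n) \<and> k \<in> N}" by (simp add: F_def vw V(2))
    \<comment> \<open>The intersection of the \<open>W n\<close> may be smaller than the coset, but
      it lies inside the coset and contains \<open>h\<close>; multiplication by \<open>N\<close>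
      then fills the coset.\<close>
    have in_coset: "u \<in> carrier G \<and> inv h \<otimes> u \<in> N" if "u \<in> (\<Inter>n. W n)" for u
    proof -
      have u: "u \<in> h \<star> V n" for n using that W(3) by blast
      have Vc: "V n \<subseteq> carrier G" for n using openin_subset[OF Vop] by simp
      have "u \<in> carrier G" using u[of 0] translate_carrier[OF D(2) Vc] by blast
      then show ?thesis using u mem_translate_iff[OF D(2) Vc] V(2) by blast
    qed
    have "F c = D"
    proof
      show "F c \<subseteq> D"
      proof
        fix x assume "x \<in> F c"
        then obtain u k where uk: "u \<in> (\<Inter>n. W n)" "k \<in> N" "x = u \<otimes> k"
          unfolding Fc by blast
        then have u: "u \<in> carrier G" "inv h \<otimes> u \<in> N" and "k \<in> carrier G" using in_coset by auto
        then have "inv h \<otimes> x = (inv h \<otimes> u) \<otimes> k" using uk D(2) by (simp add: m_assoc)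
        then have "inv h \<otimes> x \<in> N" using u uk by simp
        moreover have "x \<in> carrier G" using uk u \<open>k \<in> carrier G\<close> by simp
        ultimately show "x \<in> D" unfolding D(1) using mem_translate_iff[OF D(2) N.subset] by blast
      qed
      have "h \<in> (\<Inter>n. W n)" using W(2) by blast
      then show "D \<subseteq> F c" unfolding Fc D(1) by blast
    qed
    then show ?thesis by blast
  qed
  then show ?thesis using that by blast
qed

lemma translate_basic_coset:
  assumes "g \<in> carrier G" "D \<in> basic_cosets" shows "g \<star> D \<in> basic_cosets"
proof -
  obtain h N where D: "D = h \<star> N" "h \<in> carrier G" "N \<in> basic_subgroups"
    using assms(2) by (auto simp: basic_cosets_def)
  have "N \<subseteq> carrier G" using basic_subgroupD(1)[OF D(3)] by (rule subgroup.subset)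
  then have "g \<star> D = (g \<otimes> h) \<star> N" using assms D by (auto simp: image_image m_assoc intro!: image_cong)
  then show ?thesis using assms D unfolding basic_cosets_def by blast
qed

lemma basic_coset_carrier: "D \<in> basic_cosets \<Longrightarrow> D \<subseteq> carrier G"
  unfolding basic_cosets_def using translate_carrier basic_subgroupD(1) subgroup.subset by blast

section \<open>The algebra determined by the cosets: translations and stabilizers\<close>

definition coset_sets :: "'a set set" where
  "coset_sets = determined_sets (carrier G) basic_cosets"

text \<open>If \<open>\<F>\<close> determines \<open>a\<close>, the translated generators determine
  the translate, and they are again left cosets of the same subgroups.\<close>

lemma translate_coset_sets:
  assumes g: "g \<in> carrier G" and a: "a \<in> coset_sets" shows "g \<star> a \<in> coset_sets"
proof -
  obtain \<F> where F: "a \<subseteq> carrier G" "\<F> \<subseteq> basic_cosets" "finite \<F>" "determines (carrier G) \<F> a"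
    using determined_setsE[OF a[unfolded coset_sets_def]] .
  have "determines (carrier G) ((\<lambda>D. g \<star> D) ` \<F>) (g \<star> a)"
    unfolding determines_def
  proof (intro ballI impI)
    fix x y assume xy: "x \<in> carrier G" "y \<in> carrier G" "\<forall>D\<in>(\<lambda>D. g \<star> D) ` \<F>. x \<in> D \<longleftrightarrow> y \<in> D"
    have "inv g \<otimes> x \<in> a \<longleftrightarrow> inv g \<otimes> y \<in> a"
    proof (rule determinesD[OF F(4)])
      fix D assume D: "D \<in> \<F>"
      then have "D \<subseteq> carrier G" using F(2) basic_coset_carrier by blast
      moreover have "x \<in> g \<star> D \<longleftrightarrow> y \<in> g \<star> D" using xy(3) D by (meson imageI)
      ultimately show "inv g \<otimes> x \<in> D \<longleftrightarrow> inv g \<otimes> y \<in> D"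
        using mem_translate_iff[OF g] xy(1,2) by simp
    qed (use g xy in auto)
    then show "x \<in> g \<star> a \<longleftrightarrow> y \<in> g \<star> a" using mem_translate_iff[OF g F(1)] xy(1,2) by simp
  qed
  then show ?thesis
    unfolding coset_sets_def using F g translate_basic_coset
    by (intro determined_setsI[of _ _ "(\<lambda>D. g \<star> D) ` \<F>"]) (auto dest: subsetD[OF translate_carrier])
qed

definition stabilizes :: "'a \<Rightarrow> 'a set \<Rightarrow> bool" where
  "stabilizes g a \<longleftrightarrow> (\<forall>x\<in>carrier G. g \<otimes> x \<in> a \<longleftrightarrow> x \<in> a)"

text \<open>The coset \<open>h \<star> N\<close> is stabilized by \<open>g\<close> as soon as
  \<open>inv h \<otimes> (g \<otimes> h)\<close> lies in \<open>N\<close>, and this condition is the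
  preimage of a G-delta set under a continuous map.\<close>

lemma gdelta_stabilizer_coset:
  assumes "D \<in> basic_cosets"
  obtains S where "gdelta_in T S" "\<one> \<in> S" "\<And>g. g \<in> S \<Longrightarrow> stabilizes g D"
proof -
  obtain h N where D: "D = h \<star> N" "h \<in> carrier G" "N \<in> basic_subgroups"
    using assms by (auto simp: basic_cosets_def)
  note N = basic_subgroupD[OF D(3)]
  interpret N: subgroup N G by (rule N)
  let ?S = "{g \<in> topspace T. inv h \<otimes> (g \<otimes> h) \<in> N}"
  have "continuous_map T T (\<lambda>g. inv h \<otimes> (g \<otimes> h))"
    using D(2) by (intro continuous_mult) (auto simp: continuous_map_const)
  then have "gdelta_in T ?S" using N(2) by (rule gdelta_in_continuous_preimage)
  moreover have "\<one> \<in> ?S" using D(2) by simp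
  moreover have "stabilizes g D" if "g \<in> ?S" for g
    unfolding stabilizes_def
  proof
    fix x assume x: "x \<in> carrier G"
    have g: "g \<in> carrier G" "inv h \<otimes> (g \<otimes> h) \<in> N" using that by auto
    let ?m = "inv h \<otimes> (g \<otimes> h)" and ?y = "inv h \<otimes> x"
    have y: "?y \<in> carrier G" using D(2) x by simp
    have "h \<otimes> ?y = x" using D(2) x by (simp add: m_assoc[symmetric])
    then have eq: "inv h \<otimes> (g \<otimes> x) = ?m \<otimes> ?y" using D(2) x g y by (simp add: m_assoc)
    have "?m \<otimes> ?y \<in> N \<longleftrightarrow> ?y \<in> N"
    proof
      assume "?m \<otimes> ?y \<in> N"
      then have "inv ?m \<otimes> (?m \<otimes> ?y) \<in> N" using g(2) by blast
      moreover have "inv ?m \<otimes> (?m \<otimes> ?y) = ?y"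
        using m_assoc[of "inv ?m" ?m ?y] y g(1) D(2) by (simp add: l_inv)
      ultimately show "?y \<in> N" by simp
    qed (use g(2) in blast)
    then show "g \<otimes> x \<in> D \<longleftrightarrow> x \<in> D"
      unfolding D(1) using mem_translate_iff[OF D(2) N.subset] x g eq by simp
  qed
  ultimately show ?thesis using that by blast
qed

lemma gdelta_stabilizer:
  assumes a: "a \<in> coset_sets"
  obtains S where "gdelta_in T S" "\<one> \<in> S" "\<And>g. g \<in> S \<Longrightarrow> stabilizes g a"
proof -
  obtain \<F> where F: "a \<subseteq> carrier G" "\<F> \<subseteq> basic_cosets" "finite \<F>" "determines (carrier G) \<F> a"
    using determined_setsE[OF a[unfolded coset_sets_def]] .
  have "\<exists>S. D \<in> \<F> \<longrightarrow> gdelta_in T S \<and> \<one> \<in> S \<and> (\<forall>g\<in>S. stabilizes g D)" for D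
    using gdelta_stabilizer_coset F(2) by (metis subsetD)
  then obtain S where S: "\<And>D. D \<in> \<F> \<Longrightarrow> gdelta_in T (S D) \<and> \<one> \<in> S D \<and> (\<forall>g\<in>S D. stabilizes g D)" by metis
  \<comment> \<open>\<open>carrier G\<close> is inserted so that the intersection stays inside the
    group even when \<open>\<F>\<close> is empty.\<close>
  let ?S = "\<Inter>(insert (carrier G) (S ` \<F>))"
  have "gdelta_in T ?S"
    using S F(3) gdelta_in_topspace[of T] by (intro gdelta_in_Inter) (auto intro: countable_finite)
  moreover have "\<one> \<in> ?S" using S by auto
  moreover have "stabilizes g a" if g: "g \<in> ?S" for g
    unfolding stabilizes_def
  proof
    fix x assume x: "x \<in> carrier G"
    show "g \<otimes> x \<in> a \<longleftrightarrow> x \<in> a"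
    proof (rule determinesD[OF F(4)])
      fix D assume "D \<in> \<F>"
      then have "stabilizes g D" using g S by auto
      then show "g \<otimes> x \<in> D \<longleftrightarrow> x \<in> D" using x by (simp add: stabilizes_def)
    qed (use g x in auto)
  qed
  ultimately show ?thesis using that by blast
qed

lemma basic_subgroup_coset_set:
  assumes "N \<in> basic_subgroups" shows "N \<in> coset_sets"
proof -
  have "N \<subseteq> carrier G" using basic_subgroupD(1)[OF assms] by (rule subgroup.subset)
  then have "\<And>x. x \<in> N \<Longrightarrow> \<one> \<otimes> x = x" by auto
  then have "N = \<one> \<star> N" by simp
  then have "N \<in> basic_cosets" using assms one_closed unfolding basic_cosets_def by blast
  then show ?thesis
    unfolding coset_sets_def using basic_coset_carrier by (intro determined_sets_generator) auto
qed

lemma algebra_coset_sets: "algebra (carrier G) coset_sets"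
  unfolding coset_sets_def by (rule algebra_determined_sets)

end

section \<open>The action of the group\<close>

locale coded_topological_group = topological_group_base +
  fixes E :: "nat set \<Rightarrow> 'a set"
  assumes range_code: "range E = coset_sets" and Hausdorff_T: "Hausdorff_space T"
begin

sublocale sequence_algebra "carrier G" coset_sets E
  by (intro sequence_algebra.intro sequence_algebra_axioms.intro algebra_coset_sets range_code)
    (use one_closed in blast)

definition shift :: "'a \<Rightarrow> nat \<times> 'a \<Rightarrow> nat \<times> 'a" where
  "shift g = (\<lambda>(k, x). (k, g \<otimes> x))"

lemma shift_section: "{x. (k, x) \<in> shift g ` R} = g \<star> {x. (k, x) \<in> R}"
  by (force simp: shift_def)

lemma Domain_shift [simp]: "Domain (shift g ` R) = Domain R"
  by (force simp: shift_def)

lemma shift_shift: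
  "\<lbrakk>g \<in> carrier G; h \<in> carrier G; z \<in> UNIV \<times> carrier G\<rbrakk> \<Longrightarrow> shift g (shift h z) = shift (g \<otimes> h) z"
  by (auto simp: shift_def m_assoc)

lemma shift_seq_sets:
  assumes "g \<in> carrier G" "R \<in> seq_sets" shows "shift g ` R \<in> seq_sets"
  by (rule seq_setsI) (simp only: shift_section translate_coset_sets seq_setsD assms)

lemma shift_fin_sets:
  assumes "g \<in> carrier G" "R \<in> fin_sets" shows "shift g ` R \<in> fin_sets"
  using assms shift_seq_sets by (simp add: fin_sets_def)

lemma shift_automorphism:
  assumes g: "g \<in> carrier G"
  shows "inverse_automorphisms (shift g) (shift (inv g))"
  unfolding inverse_automorphisms_def
proof (intro conjI ballI)
  fix z assume z: "z \<in> (UNIV :: nat set) \<times> carrier G"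
  show "shift g z \<in> UNIV \<times> carrier G" "shift (inv g) z \<in> UNIV \<times> carrier G"
    using g z by (auto simp: shift_def)
  have "shift \<one> z = z" using z by (auto simp: shift_def)
  then show "shift (inv g) (shift g z) = z" "shift g (shift (inv g) z) = z"
    using g z by (simp_all add: shift_shift)
qed (use g shift_seq_sets shift_fin_sets in auto)

section \<open>The induced homomorphism into the homeomorphism group\<close>

definition stone_action :: "'a \<Rightarrow> nat set set \<Rightarrow> nat set set" where
  "stone_action g = stone_map (shift g)"

lemma stone_action_homeomorphism: "g \<in> carrier G \<Longrightarrow> stone_action g \<in> homeomorphisms stone_space"
  unfolding stone_action_def using homeomorphic_stone_map shift_automorphism by blast

lemma stone_action_hat:
  "g \<in> carrier G \<Longrightarrow> R \<in> seq_sets \<Longrightarrow> stone_action g ` hat R = hat (shift g ` R)"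
  unfolding stone_action_def using stone_map_image_hat shift_automorphism by blast

lemma stone_action_comp:
  assumes "g \<in> carrier G" "h \<in> carrier G" "p \<in> points"
  shows "stone_action g (stone_action h p) = stone_action (g \<otimes> h) p"
proof -
  have "stone_map (\<lambda>z. shift g (shift h z)) = stone_map (shift (g \<otimes> h))"
    using assms by (intro stone_map_cong shift_shift)
  then show ?thesis
    unfolding stone_action_def using stone_map_comp[OF shift_automorphism[OF assms(2)] assms(3)] by simp
qed

lemma stone_action_hom: "stone_action \<in> hom G (homeo_group stone_space)"
proof (rule homI)
  show "stone_action g \<in> carrier (homeo_group stone_space)" if "g \<in> carrier G" for g
    using stone_action_homeomorphism[OF that] by (simp add: homeo_group_def)
  fix g h assume gh: "g \<in> carrier G" "h \<in> carrier G"
  have Bij: "stone_action x \<in> Bij points" if "x \<in> carrier G" for x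
    using subgroup.subset[OF subgroup_homeomorphisms[of stone_space]] stone_action_homeomorphism[OF that]
    by (auto simp: BijGroup_def)
  have "stone_action (g \<otimes> h) = compose points (stone_action g) (stone_action h)"
  proof
    fix p
    show "stone_action (g \<otimes> h) p = compose points (stone_action g) (stone_action h) p"
      using stone_action_comp[OF gh, of p]
      by (cases "p \<in> points") (simp_all add: compose_def stone_action_def stone_map_def[of "shift (g \<otimes> h)"])
  qed
  then show "stone_action (g \<otimes> h) = stone_action g \<otimes>\<^bsub>homeo_group stone_space\<^esub> stone_action h"
    using Bij gh by (simp add: homeo_group_def BijGroup_def)
qed

text \<open>The test element is the constant sequence of a small subgroup \<open>N\<close>. If its
  translate by \<open>g\<close> lies below its translate by \<open>g0\<close> modulo finite support,
  the inclusion is exact at some coordinate, so \<open>g\<close> lies in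
  \<open>g0 \<star> N\<close>, which is inside \<open>S\<close>. One subbasic set of homeomorphisms
  therefore suffices.\<close>

lemma gdelta_separated:
  assumes S: "gdelta_in T S" and g0: "g0 \<in> S"
  obtains K U where "compactin stone_space K" "openin stone_space U" "stone_action g0 ` K \<subseteq> U"
    "{g \<in> carrier G. stone_action g ` K \<subseteq> U} \<subseteq> S"
proof -
  have g0c: "g0 \<in> carrier G" using gdelta_in_subset[OF S] g0 by auto
  let ?S = "{g \<in> topspace T. g0 \<otimes> g \<in> S}"
  have "gdelta_in T ?S"
    using gdelta_in_continuous_preimage[OF continuous_translation[OF g0c] S] .
  moreover have "\<one> \<in> ?S" using g0 g0c by simp
  ultimately obtain N where N: "N \<in> basic_subgroups" "N \<subseteq> ?S" using basic_subgroup_in_gdelta by metis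
  define R where "R = (UNIV :: nat set) \<times> N"
  have R: "R \<in> seq_sets" using basic_subgroup_coset_set[OF N(1)] by (auto simp: R_def intro: seq_setsI)
  have shR: "shift g ` R \<in> seq_sets" if "g \<in> carrier G" for g using shift_seq_sets[OF that R] .
  have "g \<in> S" if g: "g \<in> carrier G" and sub: "stone_action g ` hat R \<subseteq> hat (shift g0 ` R)" for g
  proof -
    have "shift g ` R - shift g0 ` R \<in> fin_sets"
      using sub hat_subset_iff[OF shR[OF g] shR[OF g0c]] stone_action_hat[OF g R] by simp
    then have "finite (Domain (shift g ` R - shift g0 ` R))" by (simp add: fin_sets_def)
    then obtain k where "k \<notin> Domain (shift g ` R - shift g0 ` R)" using ex_new_if_finite infinite_UNIV_nat by metis
    moreover have "\<one> \<in> N" using basic_subgroupD(1)[OF N(1)] subgroup.one_closed by blast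
    then have "(k, g) \<in> shift g ` R" using g by (force simp: shift_def R_def)
    ultimately have "(k, g) \<in> shift g0 ` R" by blast
    then obtain n where "n \<in> N" "g = g0 \<otimes> n" by (auto simp: shift_def R_def)
    then show ?thesis using N(2) by auto
  qed
  then show ?thesis
    using that[OF compact_hat[OF R] openin_hat[OF shR[OF g0c]]] stone_action_hat[OF g0c R] by auto
qed

text \<open>A sequence is fixed once each of its countably many terms is. The intersection of the
  neighbourhoods chosen for the terms is again G-delta, whereas openness would in general be lost
  here.\<close>

lemma gdelta_stabilizer_seq:
  assumes R: "R \<in> seq_sets"
  obtains S where "gdelta_in T S" "\<one> \<in> S" "\<And>g. g \<in> S \<Longrightarrow> shift g ` R = R"
proof -
  have "\<exists>S. gdelta_in T S \<and> \<one> \<in> S \<and> (\<forall>g\<in>S. stabilizes g {x. (k, x) \<in> R})" for k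
    using gdelta_stabilizer[OF seq_setsD[OF R]] by metis
  then obtain S where S: "\<And>k. gdelta_in T (S k) \<and> \<one> \<in> S k \<and> (\<forall>g\<in>S k. stabilizes g {x. (k, x) \<in> R})" by metis
  have "gdelta_in T (\<Inter>(range S))" using S by (intro gdelta_in_Inter) auto
  moreover have "\<one> \<in> \<Inter>(range S)" using S by blast
  moreover have "shift g ` R = R" if g: "g \<in> \<Inter>(range S)" for g
  proof -
    have gc: "g \<in> carrier G" using g S gdelta_in_subset[of T "S 0"] by auto
    have st: "stabilizes g {x. (k, x) \<in> R}" for k using g S by blast
    have mem: "(k, g \<otimes> x) \<in> R \<longleftrightarrow> (k, x) \<in> R" if "x \<in> carrier G" for k x
      using st[of k] that by (simp add: stabilizes_def)
    have Rc: "x \<in> carrier G" if "(k, x) \<in> R" for k x using R seq.sets_into_space that by blast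
    show ?thesis
    proof
      show "shift g ` R \<subseteq> R" using mem Rc by (auto simp: shift_def)
      show "R \<subseteq> shift g ` R"
      proof
        fix z assume "z \<in> R"
        then obtain k y where z: "z = (k, y)" "(k, y) \<in> R" by (cases z) auto
        have y: "y \<in> carrier G" using Rc z by blast
        then have "g \<otimes> (inv g \<otimes> y) = y" using gc by (simp add: m_assoc[symmetric])
        then have "(k, inv g \<otimes> y) \<in> R" "z = shift g (k, inv g \<otimes> y)"
          using mem[of "inv g \<otimes> y" k] z y gc by (simp_all add: shift_def)
        then show "z \<in> shift g ` R" by blast
      qed
    qed
  qed
  ultimately show ?thesis using that by blast
qed

text \<open>Open sets are G-delta, so elements separated by an open set have actions separated by a
  subbasic set of homeomorphisms.\<close>

lemma inj_stone_action: "inj_on stone_action (carrier G)"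
proof (rule inj_onI, rule ccontr)
  fix g h assume gh: "g \<in> carrier G" "h \<in> carrier G" "stone_action g = stone_action h" "g \<noteq> h"
  then obtain U where U: "openin T U" "g \<in> U" "h \<notin> U"
    using Hausdorff_T unfolding Hausdorff_space_def disjnt_def by (metis disjoint_iff topspace_T)
  obtain K V where KV: "stone_action g ` K \<subseteq> V" "{x \<in> carrier G. stone_action x ` K \<subseteq> V} \<subseteq> U"
    by (rule gdelta_separated[OF open_imp_gdelta_in[OF U(1)] U(2)])
  have "stone_action h ` K \<subseteq> V" using KV(1) gh(3) by simp
  then show False using KV(2) gh(2) U(3) by blast
qed

text \<open>At \<open>g0\<close> a clopen set \<open>hat R\<close> is interpolated between
  \<open>K\<close> and the preimage of \<open>U\<close>. With \<open>S\<close> a G-delta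
  neighbourhood of the identity that fixes \<open>R\<close>, every element of
  \<open>g0 \<star> S\<close> moves \<open>hat R\<close> exactly as \<open>g0\<close> does, and
  hence maps \<open>K\<close> into \<open>U\<close>.\<close>

lemma continuous_stone_action:
  "continuous_map (gdelta_modification T) (compact_open_topology stone_space) stone_action"
  unfolding compact_open_topology_def
proof (rule continuous_on_generated_topo)
  fix Q assume "Q \<in> {{f \<in> homeomorphisms stone_space. f ` K \<subseteq> U} |K U. compactin stone_space K \<and> openin stone_space U}"
  then obtain K U where Q: "Q = {f \<in> homeomorphisms stone_space. f ` K \<subseteq> U}"
    and K: "compactin stone_space K" and U: "openin stone_space U" by blast
  have eq: "stone_action -` Q \<inter> topspace (gdelta_modification T) = {g \<in> carrier G. stone_action g ` K \<subseteq> U}"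
    using stone_action_homeomorphism by (auto simp: Q topspace_gdelta_modification)
  show "openin (gdelta_modification T) (stone_action -` Q \<inter> topspace (gdelta_modification T))"
    unfolding eq
  proof (subst openin_subopen, intro ballI)
    fix g0 assume "g0 \<in> {g \<in> carrier G. stone_action g ` K \<subseteq> U}"
    then have g0: "g0 \<in> carrier G" "stone_action g0 ` K \<subseteq> U" by auto
    define V where "V = {p \<in> topspace stone_space. stone_action g0 p \<in> U}"
    have "continuous_map stone_space stone_space (stone_action g0)"
      using continuous_stone_map[OF shift_automorphism[OF g0(1)]] by (simp add: stone_action_def)
    then have "openin stone_space V"
      unfolding V_def using U by (rule openin_continuous_map_preimage)
    moreover have "K \<subseteq> V" using g0(2) compactin_subset_topspace[OF K] by (auto simp: V_def)
    ultimately obtain R where R: "R \<in> seq_sets" "K \<subseteq> hat R" "hat R \<subseteq> V"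
      using hat_between[OF K] by metis
    obtain S where S: "gdelta_in T S" "\<one> \<in> S" "\<And>g. g \<in> S \<Longrightarrow> shift g ` R = R"
      using gdelta_stabilizer_seq[OF R(1)] by metis
    let ?S = "{g \<in> topspace T. inv g0 \<otimes> g \<in> S}"
    have "gdelta_in T ?S"
      using gdelta_in_continuous_preimage[OF continuous_translation S(1)] g0(1) by simp
    then have "openin (gdelta_modification T) ?S"
      using is_base_gdelta_modification[of T] by (simp add: is_base_def)
    moreover have "g0 \<in> ?S" using g0 S(2) by simp
    moreover have "stone_action g ` K \<subseteq> U" if "g \<in> ?S" for g
    proof -
      have g: "g \<in> carrier G" "inv g0 \<otimes> g \<in> S" using that by auto
      have Rc: "R \<subseteq> UNIV \<times> carrier G" using seq.sets_into_space[OF R(1)] .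
      have "g = g0 \<otimes> (inv g0 \<otimes> g)" using g g0 by (simp add: m_assoc[symmetric])
      then have "shift g z = shift g0 (shift (inv g0 \<otimes> g) z)" if "z \<in> R" for z
        using shift_shift[of g0 "inv g0 \<otimes> g" z] g g0 that Rc by auto
      then have "shift g ` R = shift g0 ` shift (inv g0 \<otimes> g) ` R" by (simp add: image_image)
      also have "\<dots> = shift g0 ` R" using S(3)[OF g(2)] by simp
      finally have "stone_action g ` hat R = stone_action g0 ` hat R"
        using stone_action_hat g(1) g0(1) R(1) by simp
      also have "\<dots> \<subseteq> U" using R(3) by (auto simp: V_def)
      finally show ?thesis using R(2) by blast
    qed
    ultimately show "\<exists>W. openin (gdelta_modification T) W \<and> g0 \<in> W \<and> W \<subseteq> {g \<in> carrier G. stone_action g ` K \<subseteq> U}"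
      by (intro exI[of _ ?S]) auto
  qed
next
  show "stone_action ` topspace (gdelta_modification T) \<subseteq>
      \<Union>{{f \<in> homeomorphisms stone_space. f ` K \<subseteq> U} |K U. compactin stone_space K \<and> openin stone_space U}"
    using stone_action_homeomorphism topspace_compact_open_topology[of stone_space]
    unfolding compact_open_topology_def topology_generated_by_topspace topspace_gdelta_modification by auto
qed

text \<open>Openness onto the image rests on \<open>gdelta_separated\<close>: a G-delta set around
  \<open>g0\<close> contains every group element whose action lies in a suitable subbasic
  neighbourhood of the action of \<open>g0\<close>.\<close>

lemma topological_isomorphism_stone_action:
  defines "H \<equiv> stone_action ` carrier G"
  shows "subgroup H (homeo_group stone_space)"
    "topological_isomorphism G (gdelta_modification T)
       (homeo_group stone_space \<lparr>carrier := H\<rparr>) (subtopology (compact_open_topology stone_space) H) stone_action"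
proof -
  interpret hom: group_hom G "homeo_group stone_space" stone_action
    using group_homeo_group stone_action_hom is_group by (simp add: group_hom_def group_hom_axioms_def)
  show "subgroup H (homeo_group stone_space)" unfolding H_def by (rule hom.img_is_subgroup)
  let ?CO = "compact_open_topology stone_space" and ?G = "gdelta_modification T"
  have H: "H \<subseteq> homeomorphisms stone_space" using stone_action_homeomorphism by (auto simp: H_def)
  have top: "topspace (subtopology ?CO H) = H"
    using H by (auto simp: topspace_compact_open_topology)
  have "open_map ?G (subtopology ?CO H) stone_action"
    unfolding open_map_def
  proof (intro allI impI)
    fix W assume W: "openin ?G W"
    have Wc: "W \<subseteq> carrier G" using openin_subset[OF W] by (simp add: topspace_gdelta_modification)
    show "openin (subtopology ?CO H) (stone_action ` W)"
    proof (subst openin_subopen, intro ballI)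
      fix f assume "f \<in> stone_action ` W"
      then obtain g0 where g0: "g0 \<in> W" "f = stone_action g0" by blast
      then obtain S where S: "gdelta_in T S" "g0 \<in> S" "S \<subseteq> W"
        using W is_base_gdelta_modification[of T] unfolding is_base_def by blast
      obtain K U where KU: "compactin stone_space K" "openin stone_space U" "stone_action g0 ` K \<subseteq> U"
        and sep: "{g \<in> carrier G. stone_action g ` K \<subseteq> U} \<subseteq> S"
        using gdelta_separated[OF S(1,2)] .
      let ?Q = "{f \<in> homeomorphisms stone_space. f ` K \<subseteq> U}"
      have "openin ?CO ?Q"
        unfolding compact_open_topology_def using KU by (intro topology_generated_by_Basis) blast
      then have "openin (subtopology ?CO H) (?Q \<inter> H)" by (rule openin_subtopology_Int)
      moreover have "f \<in> ?Q \<inter> H"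
        using g0 KU(3) Wc stone_action_homeomorphism by (auto simp: H_def)
      moreover have "?Q \<inter> H \<subseteq> stone_action ` W" using sep S(3) by (auto simp: H_def)
      ultimately show "\<exists>V. openin (subtopology ?CO H) V \<and> f \<in> V \<and> V \<subseteq> stone_action ` W" by blast
    qed
  qed
  moreover have "continuous_map ?G (subtopology ?CO H) stone_action"
    using continuous_stone_action
    by (auto simp: continuous_map_in_subtopology H_def topspace_gdelta_modification)
  ultimately have "homeomorphic_map ?G (subtopology ?CO H) stone_action"
    using top inj_stone_action
    by (intro bijective_open_imp_homeomorphic_map) (auto simp: topspace_gdelta_modification H_def)
  moreover have "stone_action \<in> iso G (homeo_group stone_space \<lparr>carrier := H\<rparr>)"
    using stone_action_hom inj_stone_action by (auto simp: iso_def hom_def bij_betw_def H_def)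
  ultimately show "topological_isomorphism G ?G (homeo_group stone_space \<lparr>carrier := H\<rparr>)
      (subtopology ?CO H) stone_action"
    by (simp add: topological_isomorphism_def)
qed

end

theorem theorem1p1:
  fixes G :: "('a, 'm) monoid_scheme" and T :: "'a topology"
  assumes "topological_group G T"
    and "Tychonoff_space T"
    and "has_weight T continuum"
  shows "\<exists>X :: nat set set topology. Parovicenko_space X \<and>
           (\<exists>H \<phi>. subgroup H (homeo_group X) \<and>
             topological_isomorphism
               G (gdelta_modification T)
               (homeo_group X \<lparr>carrier := H\<rparr>) (subtopology (compact_open_topology X) H) \<phi>)"
proof -
  obtain \<B> where \<B>: "is_base T \<B>" "|\<B>| =o continuum"
    using assms(3) by (auto simp: has_weight_def)
  \<comment> \<open>The cardinality bound yields a surjection from the codes onto a nonempty base;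
    for the empty family any \<open>b\<close> serves.\<close>
  obtain b :: "nat set \<Rightarrow> 'a set" where b: "\<B> \<subseteq> range b"
  proof (cases "\<B> = {}")
    case False
    then show ?thesis using \<B>(2) card_of_ordLeq2[of \<B> "UNIV :: nat set set"] ordIso_iff_ordLeq that by blast
  qed (use that in blast)
  interpret G: topological_group_base G T \<B>
    using assms(1) \<B>(1)
    by (intro topological_group_base.intro topological_group_base_axioms.intro)
      (auto simp: topological_group_def)
  obtain F :: "nat set \<Rightarrow> 'a set" where "G.basic_cosets \<subseteq> range F"
    using G.basic_cosets_coded[OF b] .
  from determined_sets_coded[OF this]
  obtain E :: "nat set \<Rightarrow> 'a set" where "range E = G.coset_sets"
    unfolding G.coset_sets_def .
  then interpret coded_topological_group G T \<B> E
    using assms(2) by unfold_locales (simp_all add: Tychonoff_space_def)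
  show ?thesis
    using Parovicenko_stone topological_isomorphism_stone_action by blast
qed

end
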